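(* Consider the multi-agent system $\dot x=Ax+Bu$, $y=Cx$ composed of the $m$ agents $$\dot x_i=A_{ii}x_i+\sum_{j\in\mathcal N_i(\mathrm G_{\rm s})}A_{ij}x_j+B_{ii}u_i,\qquad y_i=C_{ii}x_i+\sum_{j\in\mathcal N_i(\mathrm G_{\rm o})}C_{ij}x_j,\qquad i\in\mathcal V=\{1,\dots,m\},$$ with communication graph $\mathrm G_{\rm c}=(\mathcal V,\mathcal E_{\rm c})$. Assume: (A1) for each $i\in\mathcal V$ the pair $(A_{ii},C_{ii})$ is observable; (A2) the dynamics graph $\mathrm G_{\rm s}$ and the sensing graph $\mathrm G_{\rm o}$ are directed acyclic graphs having a common topological ordering; (A3) $A_{ii}$ is not Hurwitz for all $i\in\mathcal V$. Let $F_i\in\mathbb R^{n_i\times p_i}$ be such that $A_{ii}-F_iC_{ii}$ is Hurwitz for all $i\in\mathcal V$, and let the consensus gains $w^{(j)}_{il}$ and $w^{(i)}_{i0}$ be as described in the context. Consider the distributed observer in which each agent $i\in\mathcal V$ runs $$\dot{\hat x}_j^{(i)}=A_{jj}\hat x_j^{(i)}+B_{jj}u_j+\sum_{l\in\mathcal N_j(\mathrm G_{\rm s})}A_{jl}\hat x_l^{(i)}+\mu\sum_{l\in\mathcal N_i(\mathrm G_{\rm c})}w_{il}^{(j)}\big(\hat x_j^{(l)}-\hat x_j^{(i)}\big),\quad j\in\mathcal V\setminus\{i\},$$ $$\dot{\hat x}_i^{(i)}=A_{ii}\hat x_i^{(i)}+B_{ii}u_i+\sum_{l\in\mathcal N_i(\mathrm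 G_{\rm s})}A_{il}\hat x_l^{(i)}+\mu\Big[w_{i0}^{(i)}\big(\bar x_i-\hat x_i^{(i)}\big)+\sum_{l\in\mathcal N_i(\mathrm G_{\rm c})}w_{il}^{(i)}\big(\hat x_i^{(l)}-\hat x_i^{(i)}\big)\Big],$$ $$\dot{\bar x}_i=A_{ii}\bar x_i+B_{ii}u_i+\sum_{l\in\mathcal N_i(\mathrm G_{\rm s})}A_{il}\hat x_l^{(i)}+F_i\Big[y_i-\Big(C_{ii}\bar x_i+\sum_{l\in\mathcal N_i(\mathrm G_{\rm o})}C_{il}\hat x_l^{(i)}\Big)\Big].$$ Then, for all sufficiently large positive numbers $\mu$ (i.e. there is $\mu^*>0$ such that for every $\mu>\mu^*$), the observer is stable, in the sense that $\lim_{t\to\infty}\|\hat x^{(i)}(t)-x(t)\|=0$ for all $i\in\mathcal V$ (for all initial conditions of the system and of the observer), if and only if $\mathrm G_{\rm c}$ is strongly connected.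
   Context: State $x_i\in\mathbb R^{n_i}$, input $u_i\in\mathbb R^{k_i}$ and output $y_i\in\mathbb R^{p_i}$ of agent $i$; $x=[x_1^\top,\dots,x_m^\top]^\top$, $u=[u_1^\top,\dots,u_m^\top]^\top$, $y=[y_1^\top,\dots,y_m^\top]^\top$, $A=[A_{ij}]$, $B=\mathrm{diag}(B_{11},\dots,B_{mm})$, $C=[C_{ij}]$, with real matrices of compatible sizes. The inputs $u_i$ are bounded signals, and the whole input $u$ is known to all agents. Graphs on $\mathcal V=\{1,\dots,m\}$: for $i\ne j$, $(j,i)$ is an edge of the dynamics graph $\mathrm G_{\rm s}$ iff $A_{ij}\neq 0$, and an edge of the sensing graph $\mathrm G_{\rm o}$ iff $C_{ij}\ne0$. In the communication graph $\mathrm G_{\rm c}$, an edge $(j,i)\in\mathcal E_{\rm c}$ (with $j\neq i$) means that agent $j$ can send information to agent $i$. For a directed graph $\mathrm G$, $\mathcal N_i(\mathrm G)=\{j\ne i:(j,i)\text{ is an edge of }\mathrm G\}$ is the in-neighbor set of $i$. A topological ordering is a listing of all nodes such that every edge's starting node is listed before its ending node. $\mathrm G_{\rm c}$ is strongly connected if there is a directed path from every node to every other node. A square matrix is Hurwitz if all its eigenvalues have strictly negative real part. Observer variables: $\hat x_j^{(i)}\in\mathbb R^{n_j}$ is agent $i$'s estimate of $x_j$, $\hat x^{(i)}=[(\hat x_1^{(i)})^\top,\dots,(\hat x_m^{(i)})^\top]^\top$, and $\bar x_i\in\mathbb R^{n_i}$ is an auxiliary variable of agent $i$. $\mu$ is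 the coupling gain. Consensus gains: for each $j\in\mathcal V$ let $\mathrm G_{\rm c}^{(j)}$ be the directed graph on $\{0,1,\dots,m\}$ with edge set $\mathcal E_{\rm c}^{(j)}=\mathcal E_{\rm c}\cup\{(0,j)\}$. The gains are the entries of fixed nonnegative weight matrices $W^{(j)}=[w^{(j)}_{sr}]_{s,r=0}^m$, independent of $\mu$, satisfying $w_{sr}^{(j)}>0$ iff $(r,s)\in\mathcal E_{\rm c}^{(j)}$, and $w_{sr}^{(j)}=0$ otherwise. *)

theory Defs
  imports "HOL-Analysis.Analysis" "Jordan_Normal_Form.Char_Poly"
begin

unbundle no vec_syntax
unbundle no inner_syntax

text \<open>
  The agents are 1, ..., m, and agent i has state, input and output dimensions n i, k i and p i.
  As these dimensions vary with i, vectors and matrices are those of Jordan_Normal_Form; a block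
  matrix is a family of blocks, and \<open>x j t\<close> is the value at time t of the j-th block of a signal.
  Signals are only considered at times \<open>t \<ge> 0\<close>.
\<close>

abbreviation vsum :: "nat \<Rightarrow> (nat \<Rightarrow> real vec) \<Rightarrow> nat set \<Rightarrow> real vec" where
  "vsum d \<equiv> finsum_vec TYPE(real) d"

definition vnorm :: "real vec \<Rightarrow> real" where
  "vnorm v = sqrt (v \<bullet> v)"

definition stack :: "nat \<Rightarrow> (nat \<Rightarrow> real vec) \<Rightarrow> real vec" where
  "stack m v = foldr (\<lambda>j w. v j @\<^sub>v w) [1..<Suc m] (0\<^sub>v 0)"

text \<open>
  \<open>solves d z f\<close>: the curve z in dimension d is a Caratheodory solution of z' = f on
  \<open>[0, \<infinity>)\<close>, where \<open>f t\<close> is the right-hand side evaluated along z (and along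
  whatever other signals it depends on). The integral form is used because inputs need not be
  continuous; when f is continuous it says that \<open>z'(t) = f t\<close> for all \<open>t \<ge> 0\<close>.
\<close>

definition solves :: "nat \<Rightarrow> (real \<Rightarrow> real vec) \<Rightarrow> (real \<Rightarrow> real vec) \<Rightarrow> bool" where
  "solves d z f \<longleftrightarrow> (\<forall>t\<ge>0. z t \<in> carrier_vec d \<and>
     (\<forall>r<d. ((\<lambda>s. f s $ r) has_integral (z t $ r - z 0 $ r)) {0..t}))"

definition bounded_signal :: "nat \<Rightarrow> (real \<Rightarrow> real vec) \<Rightarrow> bool" where
  "bounded_signal d v \<longleftrightarrow>
     (\<forall>t\<ge>0. v t \<in> carrier_vec d) \<and>
     (\<forall>r<d. (\<lambda>t. v t $ r) \<in> borel_measurable (lebesgue_on {0..})) \<and>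
     (\<exists>M. \<forall>t\<ge>0. vnorm (v t) \<le> M)"

definition hurwitz :: "real mat \<Rightarrow> bool" where
  "hurwitz M \<longleftrightarrow> (\<forall>z. eigenvalue (map_mat complex_of_real M) z \<longrightarrow> Re z < 0)"

text \<open>
  Observability of the pair (M, H): for z' = M z with output H z, the output over some finite
  time interval determines the initial state.
\<close>

definition observable :: "real mat \<Rightarrow> real mat \<Rightarrow> bool" where
  "observable M H \<longleftrightarrow> (\<exists>T>0. \<forall>z z'.
     solves (dim_row M) z (\<lambda>t. M *\<^sub>v z t) \<longrightarrow>
     solves (dim_row M) z' (\<lambda>t. M *\<^sub>v z' t) \<longrightarrow>
     (\<forall>t\<in>{0..T}. H *\<^sub>v z t = H *\<^sub>v z' t) \<longrightarrow>
     z 0 = z' 0)"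

text \<open>A pair (j, i) in an edge set is an edge from j to i.\<close>

definition coupling_graph :: "nat \<Rightarrow> (nat \<Rightarrow> nat \<Rightarrow> real mat) \<Rightarrow> (nat \<times> nat) set" where
  "coupling_graph m M = {(j, i). j \<in> {1..m} \<and> i \<in> {1..m} \<and> i \<noteq> j \<and>
     M i j \<noteq> 0\<^sub>m (dim_row (M i j)) (dim_col (M i j))}"

definition in_nbrs :: "(nat \<times> nat) set \<Rightarrow> nat \<Rightarrow> nat set" where
  "in_nbrs E i = {j. j \<noteq> i \<and> (j, i) \<in> E}"

definition topological_ordering :: "'a set \<Rightarrow> ('a \<times> 'a) set \<Rightarrow> 'a list \<Rightarrow> bool" where
  "topological_ordering V E xs \<longleftrightarrow> distinct xs \<and> set xs = V \<and>
     (\<forall>(a, b)\<in>E. \<exists>q r. q < r \<and> r < length xs \<and> xs ! q = a \<and> xs ! r = b)"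

definition strongly_connected_on :: "'a set \<Rightarrow> ('a \<times> 'a) set \<Rightarrow> bool" where
  "strongly_connected_on V E \<longleftrightarrow> (\<forall>a\<in>V. \<forall>b\<in>V. (a, b) \<in> E\<^sup>*)"

definition consensus_weights :: "nat \<Rightarrow> (nat \<times> nat) set \<Rightarrow> (nat \<Rightarrow> real mat) \<Rightarrow> bool" where
  "consensus_weights m Ec W \<longleftrightarrow> (\<forall>j\<in>{1..m}. W j \<in> carrier_mat (m + 1) (m + 1) \<and>
     (\<forall>s\<in>{0..m}. \<forall>r\<in>{0..m}.
        if (r, s) \<in> Ec \<union> {(0, j)} then W j $$ (s, r) > 0 else W j $$ (s, r) = 0))"

definition system_trajectory ::
  "nat \<Rightarrow> (nat \<Rightarrow> nat) \<Rightarrow> (nat \<Rightarrow> nat \<Rightarrow> real mat) \<Rightarrow> (nat \<Rightarrow> real mat) \<Rightarrow>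
   (nat \<Rightarrow> real \<Rightarrow> real vec) \<Rightarrow> (nat \<Rightarrow> real \<Rightarrow> real vec) \<Rightarrow> bool" where
  "system_trajectory m n A B u x \<longleftrightarrow> (\<forall>i\<in>{1..m}. solves (n i) (x i) (\<lambda>t.
     A i i *\<^sub>v x i t + vsum (n i) (\<lambda>j. A i j *\<^sub>v x j t) (in_nbrs (coupling_graph m A) i)
     + B i *\<^sub>v u i t))"

definition system_output ::
  "nat \<Rightarrow> (nat \<Rightarrow> nat) \<Rightarrow> (nat \<Rightarrow> nat \<Rightarrow> real mat) \<Rightarrow>
   (nat \<Rightarrow> real \<Rightarrow> real vec) \<Rightarrow> nat \<Rightarrow> real \<Rightarrow> real vec" where
  "system_output m p C x i t =
     C i i *\<^sub>v x i t + vsum (p i) (\<lambda>j. C i j *\<^sub>v x j t) (in_nbrs (coupling_graph m C) i)"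

text \<open>
  Agent i's estimate of \<open>x j\<close> is \<open>xh i j\<close>, and its auxiliary variable is \<open>xb i\<close>.
\<close>

definition observer_trajectory ::
  "nat \<Rightarrow> (nat \<Rightarrow> nat) \<Rightarrow> (nat \<Rightarrow> nat) \<Rightarrow>
   (nat \<Rightarrow> nat \<Rightarrow> real mat) \<Rightarrow> (nat \<Rightarrow> real mat) \<Rightarrow> (nat \<Rightarrow> nat \<Rightarrow> real mat) \<Rightarrow>
   (nat \<Rightarrow> real mat) \<Rightarrow> (nat \<times> nat) set \<Rightarrow> (nat \<Rightarrow> real mat) \<Rightarrow> real \<Rightarrow>
   (nat \<Rightarrow> real \<Rightarrow> real vec) \<Rightarrow> (nat \<Rightarrow> real \<Rightarrow> real vec) \<Rightarrow>
   (nat \<Rightarrow> nat \<Rightarrow> real \<Rightarrow> real vec) \<Rightarrow> (nat \<Rightarrow> real \<Rightarrow> real vec) \<Rightarrow> bool" where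
  "observer_trajectory m n p A B C F Ec W \<mu> u y xh xb \<longleftrightarrow>
     (\<forall>i\<in>{1..m}.
       (\<forall>j\<in>{1..m} - {i}. solves (n j) (xh i j) (\<lambda>t.
          A j j *\<^sub>v xh i j t + B j *\<^sub>v u j t
          + vsum (n j) (\<lambda>l. A j l *\<^sub>v xh i l t) (in_nbrs (coupling_graph m A) j)
          + \<mu> \<cdot>\<^sub>v vsum (n j) (\<lambda>l. W j $$ (i, l) \<cdot>\<^sub>v (xh l j t - xh i j t)) (in_nbrs Ec i)))
     \<and> solves (n i) (xh i i) (\<lambda>t.
          A i i *\<^sub>v xh i i t + B i *\<^sub>v u i t
          + vsum (n i) (\<lambda>l. A i l *\<^sub>v xh i l t) (in_nbrs (coupling_graph m A) i)
          + \<mu> \<cdot>\<^sub>v (W i $$ (i, 0) \<cdot>\<^sub>v (xb i t - xh i i t)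
               + vsum (n i) (\<lambda>l. W i $$ (i, l) \<cdot>\<^sub>v (xh l i t - xh i i t)) (in_nbrs Ec i)))
     \<and> solves (n i) (xb i) (\<lambda>t.
          A i i *\<^sub>v xb i t + B i *\<^sub>v u i t
          + vsum (n i) (\<lambda>l. A i l *\<^sub>v xh i l t) (in_nbrs (coupling_graph m A) i)
          + F i *\<^sub>v (y i t - (C i i *\<^sub>v xb i t
               + vsum (p i) (\<lambda>l. C i l *\<^sub>v xh i l t) (in_nbrs (coupling_graph m C) i)))))"

text \<open>
  Quantifying over all trajectories amounts to quantifying over all initial conditions of the
  system and of the observer.
\<close>

definition observer_stable ::
  "nat \<Rightarrow> (nat \<Rightarrow> nat) \<Rightarrow> (nat \<Rightarrow> nat) \<Rightarrow>
   (nat \<Rightarrow> nat \<Rightarrow> real mat) \<Rightarrow> (nat \<Rightarrow> real mat) \<Rightarrow> (nat \<Rightarrow> nat \<Rightarrow> real mat) \<Rightarrow>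
   (nat \<Rightarrow> real mat) \<Rightarrow> (nat \<times> nat) set \<Rightarrow> (nat \<Rightarrow> real mat) \<Rightarrow> real \<Rightarrow>
   (nat \<Rightarrow> real \<Rightarrow> real vec) \<Rightarrow> bool" where
  "observer_stable m n p A B C F Ec W \<mu> u \<longleftrightarrow>
     (\<forall>x xh xb. system_trajectory m n A B u x \<longrightarrow>
        observer_trajectory m n p A B C F Ec W \<mu> u (system_output m p C x) xh xb \<longrightarrow>
        (\<forall>i\<in>{1..m}.
          ((\<lambda>t. vnorm (stack m (\<lambda>j. xh i j t) - stack m (\<lambda>j. x j t))) \<longlongrightarrow> 0) at_top))"

end

theory Submission
  imports Defs "Jordan_Normal_Form.Schur_Decomposition" "Jordan_Normal_Form.Spectral_Radius"
    "HOL-Real_Asymp.Real_Asymp"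
begin

text \<open>
  The estimation errors satisfy a homogeneous linear equation in which the inputs cancel. Along the
  common topological ordering it is triangular: if the errors of all predecessors of \<open>x j\<close>
  vanish asymptotically, then the error of the auxiliary variable of agent j does, as
  \<open>A j j - F j * C j j\<close> is Hurwitz. The errors of the m estimates of \<open>x j\<close> then obey
  \<open>Z' = A j j * Z - \<mu> * Z * L\<^sup>T\<close> up to vanishing terms, where L is the Laplacian of the
  communication graph grounded at agent j. If that graph is strongly connected, the eigenvalues of L
  have positive real parts, so a large \<open>\<mu>\<close> dominates the eigenvalues of \<open>A j j\<close>.
  Conversely, if some agent is not reachable from a, the agents not reachable from a may share an
  unstable motion of \<open>A a a\<close> as their error in the estimate of \<open>x a\<close>.
\<close>

section \<open>Asymptotically forced linear equations\<close>

text \<open>Inputs are merely measurable, so a trajectory satisfies an integral equation and need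
  not be differentiable. Trajectories are therefore compared only through their errors: subtracting
  the integral equation of \<open>x\<close> removes the input, and the remaining right-hand side is
  continuous in time, so errors are differentiable for \<open>t > 0\<close>. The threshold for \<mu>
  comes from the operator Z -> D Z - \<mu> Z L^T, whose eigenvalues are \<alpha> - \<mu> \<beta>
  with \<alpha>, \<beta> eigenvalues of D and L. It depends on the matrices and weights but not on
  the input. Necessity has an obstacle of its own: stability quantifies over all trajectories and
  would hold vacuously if there were none. Trajectories have to be constructed, for the system under
  any bounded input and for the errors with some coordinates prescribed in advance. Both
  constructions come from one global existence result for linear integral equations.\<close>

lemma scalar_ode_decay:
  fixes w h :: "real \<Rightarrow> complex"
  assumes deriv: "\<And>t. t > 0 \<Longrightarrow> (w has_vector_derivative (\<gamma> * w t + h t)) (at t)"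
    and Re: "Re \<gamma> < 0" and h: "(h \<longlongrightarrow> 0) at_top"
  shows "(w \<longlongrightarrow> 0) at_top"
proof (rule tendstoI)
  fix e :: real assume e: "e > 0"
  define a where "a = - Re \<gamma>"
  have a: "a > 0" using Re by (simp add: a_def)
  \<comment> \<open>Integrating exp (a s) produces a factor 1 / a, so with this bound on the forcing
    its contribution to \<open>w\<close> is at most e / 2.\<close>
  from tendstoD[OF h, of "a * e / 2"] a e
  have "\<forall>\<^sub>F t in at_top. norm (h t) < a * e / 2" by (simp add: dist_norm)
  then obtain T0 where T0: "\<And>t. t \<ge> T0 \<Longrightarrow> norm (h t) < a * e / 2"
    unfolding eventually_at_top_linorder by blast
  \<comment> \<open>The equation is given for \<open>t > 0\<close> only, so the starting time has to
    be positive.\<close>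
  define T where "T = max T0 1"
  have T: "T > 0" and hT: "\<And>t. t \<ge> T \<Longrightarrow> norm (h t) < a * e / 2"
    using T0 by (auto simp: T_def)
  define v where "v t = exp (- (complex_of_real t * \<gamma>)) * w t" for t
  have expn: "norm (exp (- (complex_of_real t * \<gamma>))) = exp (a * t)" for t
    by (simp add: a_def algebra_simps)
  have dv: "(v has_vector_derivative exp (- (complex_of_real t * \<gamma>)) * h t) (at t)" if "t > 0" for t
  proof -
    have "((\<lambda>t. exp (- (complex_of_real t * \<gamma>))) has_vector_derivative
        - \<gamma> * exp (- (complex_of_real t * \<gamma>))) (at t)"
      by (rule has_vector_derivative_real_field[where f = "\<lambda>z. exp (- (z * \<gamma>))"])
        (auto intro!: derivative_eq_intros)
    from has_vector_derivative_mult[OF this deriv[OF that]]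
    show ?thesis unfolding v_def by (simp add: algebra_simps)
  qed
  have bound: "norm (w t) \<le> exp (- (a * t)) * norm (v T) + e / 2" if t: "t > T" for t
  proof -
    have "norm (v t - v T) \<le> e / 2 * exp (a * t) - e / 2 * exp (a * T)"
    proof (rule differentiable_bound_general[OF t,
          where f' = "\<lambda>t. exp (- (complex_of_real t * \<gamma>)) * h t" and \<phi>' = "\<lambda>t. exp (a * t) * (a * e / 2)"])
      show "continuous_on {T..t} v"
        using T by (intro continuous_at_imp_continuous_on ballI has_vector_derivative_continuous[OF dv]) auto
      show "continuous_on {T..t} (\<lambda>t. e / 2 * exp (a * t))"
        by (intro continuous_intros)
      fix x assume x: "T < x" "x < t"
      show "(v has_vector_derivative exp (- (complex_of_real x * \<gamma>)) * h x) (at x)"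
        using dv T x by auto
      show "((\<lambda>t. e / 2 * exp (a * t)) has_vector_derivative exp (a * x) * (a * e / 2)) (at x)"
        by (auto intro!: derivative_eq_intros simp flip: has_real_derivative_iff_has_vector_derivative)
      show "norm (exp (- (complex_of_real x * \<gamma>)) * h x) \<le> exp (a * x) * (a * e / 2)"
        unfolding norm_mult expn using hT[of x] x by (intro mult_left_mono) auto
    qed
    moreover have "e / 2 * exp (a * T) \<ge> 0" using e by simp
    ultimately have "norm (v t) \<le> norm (v T) + e / 2 * exp (a * t)"
      using norm_triangle_sub[of "v t" "v T"] by linarith
    moreover have "norm (w t) = exp (- (a * t)) * norm (v t)"
      unfolding v_def norm_mult expn by (simp add: exp_minus)
    ultimately have "norm (w t) \<le> exp (- (a * t)) * (norm (v T) + e / 2 * exp (a * t))"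
      by simp
    also have "\<dots> = exp (- (a * t)) * norm (v T) + e / 2"
      by (simp add: algebra_simps exp_minus)
    finally show ?thesis .
  qed
  have "((\<lambda>t. exp (- (a * t)) * norm (v T)) \<longlongrightarrow> 0) at_top"
    using a by real_asymp
  from tendstoD[OF this, of "e / 2"] e
  have "\<forall>\<^sub>F t in at_top. exp (- (a * t)) * norm (v T) < e / 2" by (simp add: dist_norm)
  with eventually_gt_at_top[of T] show "\<forall>\<^sub>F t in at_top. dist (w t) 0 < e"
    by eventually_elim (use bound in force)
qed

text \<open>Two facts of the decomposition drive the later change of coordinates: Q turns an
  equation with D into one with the triangular T, and P recovers the old coordinates. The diagonal
  of T lists the roots of the characteristic polynomial, hence eigenvalues.\<close>

lemma complex_schur:
  fixes D :: "complex mat"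
  assumes D: "D \<in> carrier_mat N N"
  obtains T P Q where "T \<in> carrier_mat N N" "P \<in> carrier_mat N N" "Q \<in> carrier_mat N N"
    "Q * D = T * Q" "P * Q = 1\<^sub>m N" "upper_triangular T"
    "\<And>r. r < N \<Longrightarrow> eigenvalue D (T $$ (r, r))"
proof -
  from char_poly_factorized[OF D] obtain as
    where as: "char_poly D = (\<Prod>a\<leftarrow>as. [:- a, 1:])" "length as = N" by auto
  obtain T P Q where s: "schur_decomposition D as = (T, P, Q)" by (metis prod_cases3)
  from schur_decomposition[OF D as(1) s]
  have sim: "similar_mat_wit D T P Q" and ut: "upper_triangular T" and dg: "diag_mat T = as" by auto
  from similar_mat_witD2[OF D sim]
  have c: "T \<in> carrier_mat N N" "P \<in> carrier_mat N N" "Q \<in> carrier_mat N N"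
    and PQ: "P * Q = 1\<^sub>m N" and QP: "Q * P = 1\<^sub>m N" and eq: "D = P * T * Q" by auto
  have "Q * D = Q * (P * (T * Q))" using eq c by (simp add: assoc_mult_mat[of _ N N _ N _ N])
  also have "\<dots> = (Q * P) * (T * Q)" using c by (simp add: assoc_mult_mat[of Q N N P N "T * Q" N])
  also have "\<dots> = T * Q" using c QP by simp
  finally have "Q * D = T * Q" .
  moreover have "eigenvalue D (T $$ (r, r))" if "r < N" for r
  proof -
    have "T $$ (r, r) \<in> set as" using that c(1) unfolding dg[symmetric] diag_mat_def by auto
    then show ?thesis unfolding eigenvalue_root_char_poly[OF D] as(1)
      by (auto simp: poly_prod_list prod_list_zero_iff image_iff)
  qed
  ultimately show ?thesis using that c PQ ut by blast
qed

lemma mult_entry_sum: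
  assumes "X \<in> carrier_mat N K" "Y \<in> carrier_mat K L" "i < N" "j < L"
  shows "(X * Y) $$ (i, j) = (\<Sum>k<K. X $$ (i, k) * Y $$ (k, j))"
  using assms by (auto simp: scalar_prod_def lessThan_atLeast0)

lemma has_vector_derivative_cmult_sum:
  fixes z :: "'a \<Rightarrow> real \<Rightarrow> complex"
  assumes "\<And>r. r \<in> S \<Longrightarrow> (z r has_vector_derivative z' r) (at t)"
  shows "((\<lambda>t. \<Sum>r\<in>S. c r * z r t) has_vector_derivative (\<Sum>r\<in>S. c r * z' r)) (at t)"
  using assms by (intro has_vector_derivative_sum has_vector_derivative_mult_right) auto

text \<open>Schur triangularisation of D and L decouples the equation into scalar ones, solved from
  the last component to the first.\<close>

lemma sylvester_ode_decay_triangular: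
  fixes z h :: "nat \<Rightarrow> nat \<Rightarrow> real \<Rightarrow> complex"
  assumes T: "T \<in> carrier_mat N N" "upper_triangular T"
    and L: "L \<in> carrier_mat M M" "upper_triangular L"
    and Re: "\<And>r i. r < N \<Longrightarrow> i < M \<Longrightarrow> Re (T $$ (r, r)) < \<mu> * Re (L $$ (i, i))"
    and deriv: "\<And>i r t. i < M \<Longrightarrow> r < N \<Longrightarrow> t > 0 \<Longrightarrow> (z i r has_vector_derivative
        ((\<Sum>s<N. T $$ (r, s) * z i s t) - \<mu> * (\<Sum>l<M. L $$ (i, l) * z l r t) + h i r t)) (at t)"
    and h: "\<And>i r. i < M \<Longrightarrow> r < N \<Longrightarrow> (h i r \<longlongrightarrow> 0) at_top"
    and "i < M" "r < N"
  shows "(z i r \<longlongrightarrow> 0) at_top"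
  using \<open>i < M\<close> \<open>r < N\<close>
\<comment> \<open>The equation for (i, r) is forced only by the components (i, s) with s > r and (l,
  r) with l > i. Both have a smaller measure.\<close>
proof (induction "(M - i) + (N - r)" arbitrary: i r rule: less_induct)
  case less
  have dT: "(\<Sum>s<N. T $$ (r, s) * z i s t) = T $$ (r, r) * z i r t + (\<Sum>s\<in>{r<..<N}. T $$ (r, s) * z i s t)" for t
  proof -
    have "(\<Sum>s<N. T $$ (r, s) * z i s t) = (\<Sum>s\<in>insert r {r<..<N}. T $$ (r, s) * z i s t)"
      using T less.prems by (intro sum.mono_neutral_right) auto
    then show ?thesis by simp
  qed
  have dL: "(\<Sum>l<M. L $$ (i, l) * z l r t) = L $$ (i, i) * z i r t + (\<Sum>l\<in>{i<..<M}. L $$ (i, l) * z l r t)" for t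
  proof -
    have "(\<Sum>l<M. L $$ (i, l) * z l r t) = (\<Sum>l\<in>insert i {i<..<M}. L $$ (i, l) * z l r t)"
      using L less.prems by (intro sum.mono_neutral_right) auto
    then show ?thesis by simp
  qed
  define g where "g t = (\<Sum>s\<in>{r<..<N}. T $$ (r, s) * z i s t)
      - complex_of_real \<mu> * (\<Sum>l\<in>{i<..<M}. L $$ (i, l) * z l r t) + h i r t" for t
  show ?case
  proof (rule scalar_ode_decay[where h = g])
    show "(z i r has_vector_derivative (T $$ (r, r) - \<mu> * L $$ (i, i)) * z i r t + g t) (at t)"
      if "t > 0" for t
      using deriv[OF less.prems that] unfolding dT dL g_def by (simp add: algebra_simps)
    show "Re (T $$ (r, r) - \<mu> * L $$ (i, i)) < 0" using Re[of r i] less.prems by simp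
    have "((\<lambda>t. (\<Sum>s\<in>{r<..<N}. T $$ (r, s) * z i s t)
      - complex_of_real \<mu> * (\<Sum>l\<in>{i<..<M}. L $$ (i, l) * z l r t) + h i r t) \<longlongrightarrow>
        (\<Sum>s\<in>{r<..<N}. T $$ (r, s) * 0)
      - complex_of_real \<mu> * (\<Sum>l\<in>{i<..<M}. L $$ (i, l) * 0) + 0) at_top"
      using less.prems by (intro tendsto_intros less.hyps h) auto
    then show "(g \<longlongrightarrow> 0) at_top" unfolding g_def by simp
  qed
qed

text \<open>In matrix form this is Z' = D Z - \<mu> Z L^T + H, where \<open>z i\<close> is column i
  of Z. The hypothesis on real parts puts all eigenvalues \<alpha> - \<mu> \<beta> of the linear
  part into the open left half-plane. Q and Q' act on different indices of \<open>z\<close>, so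
  triangularising D leaves the coupling through L untouched, and vice versa.\<close>

lemma sylvester_ode_decay:
  fixes z h :: "nat \<Rightarrow> nat \<Rightarrow> real \<Rightarrow> complex"
  assumes D: "D \<in> carrier_mat N N" and L: "L \<in> carrier_mat M M"
    and Re: "\<And>\<alpha> \<beta>. eigenvalue D \<alpha> \<Longrightarrow> eigenvalue L \<beta> \<Longrightarrow> Re \<alpha> < \<mu> * Re \<beta>"
    and deriv: "\<And>i r t. i < M \<Longrightarrow> r < N \<Longrightarrow> t > 0 \<Longrightarrow> (z i r has_vector_derivative
        ((\<Sum>s<N. D $$ (r, s) * z i s t) - \<mu> * (\<Sum>l<M. L $$ (i, l) * z l r t) + h i r t)) (at t)"
    and h: "\<And>i r. i < M \<Longrightarrow> r < N \<Longrightarrow> (h i r \<longlongrightarrow> 0) at_top"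
    and "i < M" "r < N"
  shows "(z i r \<longlongrightarrow> 0) at_top"
proof -
  from complex_schur[OF D] obtain T P Q where c: "T \<in> carrier_mat N N" "P \<in> carrier_mat N N" "Q \<in> carrier_mat N N"
    and QD: "Q * D = T * Q" and PQ: "P * Q = 1\<^sub>m N" and ut: "upper_triangular T"
    and ev: "\<And>r. r < N \<Longrightarrow> eigenvalue D (T $$ (r, r))" by metis
  from complex_schur[OF L] obtain T' P' Q' where c': "T' \<in> carrier_mat M M" "P' \<in> carrier_mat M M" "Q' \<in> carrier_mat M M"
    and QL: "Q' * L = T' * Q'" and PQ': "P' * Q' = 1\<^sub>m M" and ut': "upper_triangular T'"
    and ev': "\<And>r. r < M \<Longrightarrow> eigenvalue L (T' $$ (r, r))" by metis
  define w where "w i q t = (\<Sum>r<N. Q $$ (q, r) * z i r t)" for i q t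
  define v where "v p q t = (\<Sum>i<M. Q' $$ (p, i) * w i q t)" for p q t
  define hw where "hw i q t = (\<Sum>r<N. Q $$ (q, r) * h i r t)" for i q t
  define hv where "hv p q t = (\<Sum>i<M. Q' $$ (p, i) * hw i q t)" for p q t
  have intertwine: "(\<Sum>r<K. X $$ (q, r) * (\<Sum>s<K. Y $$ (r, s) * f s)) = (\<Sum>s<K. Z $$ (q, s) * (\<Sum>r<K. X $$ (s, r) * f r))"
    if "X \<in> carrier_mat K K" "Y \<in> carrier_mat K K" "Z \<in> carrier_mat K K" "X * Y = Z * X" "q < K"
    for X Y Z :: "complex mat" and K q f
  proof -
    have "(\<Sum>r<K. X $$ (q, r) * (\<Sum>s<K. Y $$ (r, s) * f s)) = (\<Sum>s<K. (\<Sum>r<K. X $$ (q, r) * Y $$ (r, s)) * f s)"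
      unfolding sum_distrib_left sum_distrib_right by (subst sum.swap) (simp add: mult.assoc)
    also have "\<dots> = (\<Sum>s<K. (\<Sum>r<K. Z $$ (q, r) * X $$ (r, s)) * f s)"
      using mult_entry_sum[OF that(1,2,5)] mult_entry_sum[OF that(3,1,5)] that(4)
      by (intro sum.cong refl) (simp add: lessThan_def)
    also have "\<dots> = (\<Sum>s<K. Z $$ (q, s) * (\<Sum>r<K. X $$ (s, r) * f r))"
      unfolding sum_distrib_left sum_distrib_right by (subst sum.swap) (simp add: mult.assoc)
    finally show ?thesis .
  qed
  have recover: "(\<Sum>q<K. X $$ (r, q) * (\<Sum>s<K. Y $$ (q, s) * f s)) = f r"
    if "X \<in> carrier_mat K K" "Y \<in> carrier_mat K K" "X * Y = 1\<^sub>m K" "r < K"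
    for X Y :: "complex mat" and K r f
  proof -
    have "(\<Sum>q<K. X $$ (r, q) * (\<Sum>s<K. Y $$ (q, s) * f s)) = (\<Sum>s<K. (\<Sum>q<K. X $$ (r, q) * Y $$ (q, s)) * f s)"
      unfolding sum_distrib_left sum_distrib_right by (subst sum.swap) (simp add: mult.assoc)
    also have "\<dots> = (\<Sum>s<K. (if r = s then 1 else 0) * f s)"
      using mult_entry_sum[OF that(1,2,4)] that(3,4) by (intro sum.cong refl) (simp add: one_mat_def)
    also have "\<dots> = f r" using that(4) by (simp add: if_distrib[of "\<lambda>x. x * _"] cong: if_cong)
    finally show ?thesis .
  qed
  have dw: "(w i q has_vector_derivative
        ((\<Sum>s<N. T $$ (q, s) * w i s t) - \<mu> * (\<Sum>l<M. L $$ (i, l) * w l q t) + hw i q t)) (at t)"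
    if "i < M" "q < N" "t > 0" for i q t
  proof -
    have "(w i q has_vector_derivative (\<Sum>r<N. Q $$ (q, r) *
        ((\<Sum>s<N. D $$ (r, s) * z i s t) - \<mu> * (\<Sum>l<M. L $$ (i, l) * z l r t) + h i r t))) (at t)"
      unfolding w_def using that by (intro has_vector_derivative_cmult_sum deriv) auto
    moreover have "(\<Sum>r<N. Q $$ (q, r) *
        ((\<Sum>s<N. D $$ (r, s) * z i s t) - \<mu> * (\<Sum>l<M. L $$ (i, l) * z l r t) + h i r t))
      = (\<Sum>r<N. Q $$ (q, r) * (\<Sum>s<N. D $$ (r, s) * z i s t))
        - \<mu> * (\<Sum>r<N. Q $$ (q, r) * (\<Sum>l<M. L $$ (i, l) * z l r t)) + hw i q t"
      by (simp add: hw_def algebra_simps sum.distrib sum_subtractf sum_distrib_left)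
    moreover have "(\<Sum>r<N. Q $$ (q, r) * (\<Sum>l<M. L $$ (i, l) * z l r t)) = (\<Sum>l<M. L $$ (i, l) * w l q t)"
      unfolding w_def sum_distrib_left by (subst sum.swap) (simp add: algebra_simps)
    ultimately show ?thesis
      using intertwine[OF c(3) D c(1) QD that(2), of "\<lambda>s. z i s t"] by (simp add: w_def)
  qed
  have dv: "(v p q has_vector_derivative
        ((\<Sum>s<N. T $$ (q, s) * v p s t) - \<mu> * (\<Sum>l<M. T' $$ (p, l) * v l q t) + hv p q t)) (at t)"
    if "p < M" "q < N" "t > 0" for p q t
  proof -
    have "(v p q has_vector_derivative (\<Sum>i<M. Q' $$ (p, i) *
        ((\<Sum>s<N. T $$ (q, s) * w i s t) - \<mu> * (\<Sum>l<M. L $$ (i, l) * w l q t) + hw i q t))) (at t)"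
      unfolding v_def using that by (intro has_vector_derivative_cmult_sum dw) auto
    moreover have "(\<Sum>i<M. Q' $$ (p, i) *
        ((\<Sum>s<N. T $$ (q, s) * w i s t) - \<mu> * (\<Sum>l<M. L $$ (i, l) * w l q t) + hw i q t))
      = (\<Sum>i<M. Q' $$ (p, i) * (\<Sum>s<N. T $$ (q, s) * w i s t))
        - \<mu> * (\<Sum>i<M. Q' $$ (p, i) * (\<Sum>l<M. L $$ (i, l) * w l q t)) + hv p q t"
      by (simp add: hv_def algebra_simps sum.distrib sum_subtractf sum_distrib_left)
    moreover have "(\<Sum>i<M. Q' $$ (p, i) * (\<Sum>s<N. T $$ (q, s) * w i s t)) = (\<Sum>s<N. T $$ (q, s) * v p s t)"
      unfolding v_def sum_distrib_left by (subst sum.swap) (simp add: algebra_simps)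
    ultimately show ?thesis
      using intertwine[OF c'(3) L c'(1) QL that(1), of "\<lambda>s. w s q t"] by (simp add: v_def)
  qed
  have sum0: "((\<lambda>t. \<Sum>a<K. c a * f a t) \<longlongrightarrow> 0) at_top"
    if "\<And>a. a < K \<Longrightarrow> (f a \<longlongrightarrow> 0) at_top" for K :: nat and c :: "nat \<Rightarrow> complex" and f
  proof -
    have "((\<lambda>t. \<Sum>a<K. c a * f a t) \<longlongrightarrow> (\<Sum>a<K. c a * 0)) at_top"
      using that by (intro tendsto_intros) auto
    then show ?thesis by simp
  qed
  have hw0: "(hw i q \<longlongrightarrow> 0) at_top" if "i < M" for i q
    unfolding hw_def using that h by (intro sum0) auto
  have hv0: "(hv p q \<longlongrightarrow> 0) at_top" for p q
    unfolding hv_def using hw0 by (intro sum0) auto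
  have v0: "(v p q \<longlongrightarrow> 0) at_top" if "p < M" "q < N" for p q
    by (rule sylvester_ode_decay_triangular[OF c(1) ut c'(1) ut' _ dv hv0 that])
      (use Re ev ev' in auto)
  have w0: "(w i q \<longlongrightarrow> 0) at_top" if "i < M" "q < N" for i q
  proof -
    have "w i q = (\<lambda>t. \<Sum>p<M. P' $$ (i, p) * v p q t)"
      unfolding v_def using recover[OF c'(2,3) PQ' that(1)] by metis
    then show ?thesis using v0 that by (auto intro: sum0)
  qed
  have "z i r = (\<lambda>t. \<Sum>q<N. P $$ (r, q) * w i q t)"
    unfolding w_def using recover[OF c(2,3) PQ \<open>r < N\<close>] by metis
  then show ?thesis using w0 \<open>i < M\<close> by (auto intro: sum0)
qed

section \<open>The grounded Laplacian\<close>

text \<open>A maximum principle. Suppose Re \<nu> \<le> 0 and take a node where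
  \<open>norm (v i)\<close> is maximal. Its diagonal coefficient d, the ground weight plus all
  in-weights, satisfies d \<le> |d - \<nu>|, so the weighted sum over the neighbours has to be as
  large as it can be: the ground weight is zero and every in-neighbour is maximal as well. Following
  a path backwards leads from a maximal node to \<open>j\<close>, whose ground weight is
  positive.\<close>

lemma grounded_laplacian_Re_pos:
  fixes w :: "'a \<Rightarrow> 'a \<Rightarrow> real" and b :: "'a \<Rightarrow> real" and v :: "'a \<Rightarrow> complex"
  assumes fin: "finite V"
    and w: "\<And>i l. i \<in> V \<Longrightarrow> l \<in> V \<Longrightarrow> w i l \<ge> 0" and b: "\<And>i. i \<in> V \<Longrightarrow> b i \<ge> 0"
    and E: "\<And>i l. (l, i) \<in> E \<Longrightarrow> l \<in> V \<and> i \<in> V \<and> w i l > 0"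
    and j: "j \<in> V" "b j > 0" and reach: "\<And>i. i \<in> V \<Longrightarrow> (j, i) \<in> E\<^sup>*"
    and eig: "\<And>i. i \<in> V \<Longrightarrow> b i * v i + (\<Sum>l\<in>V. w i l * (v i - v l)) = \<nu> * v i"
    and nz: "\<exists>i\<in>V. v i \<noteq> 0"
  shows "Re \<nu> > 0"
proof (rule ccontr)
  assume "\<not> Re \<nu> > 0"
  define X where "X = Max ((\<lambda>i. norm (v i)) ` V)"
  have le: "norm (v i) \<le> X" if "i \<in> V" for i
    unfolding X_def using fin that by (intro Max_ge) auto
  from nz obtain i0 where "i0 \<in> V" "v i0 \<noteq> 0" by blast
  with le[of i0] have X: "X > 0" by (smt (verit) zero_less_norm_iff)
  have "X \<in> (\<lambda>i. norm (v i)) ` V" unfolding X_def using fin j by (intro Max_in) auto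
  then obtain k where k: "k \<in> V" "norm (v k) = X" by auto
  have step: "b i = 0 \<and> (\<forall>l\<in>V. w i l > 0 \<longrightarrow> norm (v l) = X)" if i: "i \<in> V" "norm (v i) = X" for i
  proof -
    define d where "d = b i + (\<Sum>l\<in>V. w i l)"
    have "d * v i - (\<Sum>l\<in>V. w i l * v l) = \<nu> * v i"
      using eig[OF i(1)] by (simp add: d_def algebra_simps sum_subtractf sum_distrib_right sum_distrib_left)
    then have "(d - \<nu>) * v i = (\<Sum>l\<in>V. w i l * v l)" by (simp add: algebra_simps)
    then have "norm (d - \<nu>) * X = norm (\<Sum>l\<in>V. w i l * v l)" by (metis i(2) norm_mult)
    also have "\<dots> \<le> (\<Sum>l\<in>V. w i l * norm (v l))"
      by (rule order_trans[OF norm_sum]) (use w i in \<open>auto simp: norm_mult intro!: sum_mono\<close>)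
    finally have "norm (d - \<nu>) * X \<le> (\<Sum>l\<in>V. w i l * norm (v l))" .
    \<comment> \<open>This is the only place where the assumption on the real part of \<nu>
      enters.\<close>
    moreover have "d \<le> norm (d - \<nu>)"
      using complex_Re_le_cmod[of "d - \<nu>"] \<open>\<not> Re \<nu> > 0\<close> by simp
    ultimately have "d * X \<le> (\<Sum>l\<in>V. w i l * norm (v l))"
      using X by (meson mult_right_mono order_trans less_imp_le)
    then have le0: "b i * X + (\<Sum>l\<in>V. w i l * (X - norm (v l))) \<le> 0"
      by (simp add: d_def algebra_simps sum_subtractf sum_distrib_left sum_distrib_right)
    have nn: "w i l * (X - norm (v l)) \<ge> 0" if "l \<in> V" for l using w le i that by simp
    then have "(\<Sum>l\<in>V. w i l * (X - norm (v l))) \<ge> 0" by (rule sum_nonneg)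
    moreover have "b i * X \<ge> 0" using b i X by simp
    ultimately have "b i * X = 0" "(\<Sum>l\<in>V. w i l * (X - norm (v l))) = 0" using le0 by linarith+
    then have "b i = 0" "\<forall>l\<in>V. w i l * (X - norm (v l)) = 0"
      using X nn fin by (auto simp: sum_nonneg_eq_0_iff)
    then show ?thesis by fastforce
  qed
  from reach[OF k(1)] k have "j \<in> V \<and> norm (v j) = X"
    by (induction rule: converse_rtrancl_induct) (use step E in blast)+
  with step[of j] j show False by simp
qed

lemma mult_mat_vec_index_sum:
  assumes "M \<in> carrier_mat R N" "v \<in> carrier_vec N" "r < R"
  shows "(M *\<^sub>v v) $ r = (\<Sum>s<N. M $$ (r, s) * v $ s)"
  using assms by (auto simp: scalar_prod_def lessThan_atLeast0)

text \<open>Row and column i of this matrix belong to agent i + 1; the reference node 0 of the weights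
  only contributes to the diagonal.\<close>

definition grounded_laplacian :: "nat \<Rightarrow> real mat \<Rightarrow> complex mat" where
  "grounded_laplacian m W = mat m m (\<lambda>(i, l). complex_of_real
     ((if i = l then \<Sum>s\<le>m. W $$ (Suc i, s) else 0) - W $$ (Suc i, Suc l)))"

lemma grounded_laplacian_carrier: "grounded_laplacian m W \<in> carrier_mat m m"
  by (simp add: grounded_laplacian_def)

lemma grounded_laplacian_sum:
  fixes v :: "nat \<Rightarrow> complex"
  assumes "i < m"
  shows "(\<Sum>l<m. grounded_laplacian m W $$ (i, l) * v (Suc l))
    = W $$ (Suc i, 0) * v (Suc i) + (\<Sum>l\<in>{1..m}. W $$ (Suc i, l) * (v (Suc i) - v l))"
proof -
  have "(\<Sum>l<m. grounded_laplacian m W $$ (i, l) * v (Suc l))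
    = (\<Sum>l<m. (if i = l then of_real (\<Sum>s\<le>m. W $$ (Suc i, s)) * v (Suc l) else 0)) - (\<Sum>l<m. W $$ (Suc i, Suc l) * v (Suc l))"
    unfolding sum_subtractf[symmetric] using assms
    by (intro sum.cong) (auto simp: grounded_laplacian_def algebra_simps)
  also have "\<dots> = of_real (\<Sum>s\<le>m. W $$ (Suc i, s)) * v (Suc i) - (\<Sum>l\<in>{1..m}. W $$ (Suc i, l) * v l)"
    using assms by (simp add: sum.atLeast1_atMost_eq)
  also have "(\<Sum>s\<le>m. W $$ (Suc i, s)) = W $$ (Suc i, 0) + (\<Sum>l\<in>{1..m}. W $$ (Suc i, l))"
    by (simp add: sum.atMost_shift sum.atLeast1_atMost_eq)
  finally show ?thesis
    by (simp add: algebra_simps sum_subtractf sum_distrib_left sum_distrib_right)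
qed

lemma grounded_laplacian_eigenvalue:
  assumes W: "consensus_weights m Ec W" and Ec: "Ec \<subseteq> {1..m} \<times> {1..m}"
    and sc: "strongly_connected_on {1..m} Ec" and j: "j \<in> {1..m}"
    and eig: "eigenvalue (grounded_laplacian m (W j)) \<nu>"
  shows "Re \<nu> > 0"
proof -
  from eig obtain u where u: "u \<in> carrier_vec m" "u \<noteq> 0\<^sub>v m"
    and Lu: "grounded_laplacian m (W j) *\<^sub>v u = \<nu> \<cdot>\<^sub>v u"
    unfolding eigenvalue_def eigenvector_def using grounded_laplacian_carrier[of m "W j"] by auto
  define v where "v i = u $ (i - 1)" for i
  have Wj: "if (r, s) \<in> Ec \<union> {(0, j)} then W j $$ (s, r) > 0 else W j $$ (s, r) = 0"
    if "s \<le> m" "r \<le> m" for s r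
    using W j that unfolding consensus_weights_def by auto
  show ?thesis
  proof (rule grounded_laplacian_Re_pos[where V = "{1..m}" and w = "\<lambda>i l. W j $$ (i, l)"
        and b = "\<lambda>i. W j $$ (i, 0)" and j = j and E = Ec and v = v])
    show "W j $$ (i, l) \<ge> 0" if "i \<in> {1..m}" "l \<in> {1..m}" for i l
      using Wj[of i l] that by (auto split: if_splits)
    show "W j $$ (i, 0) \<ge> 0" if "i \<in> {1..m}" for i
      using Wj[of i 0] that by (auto split: if_splits)
    show "l \<in> {1..m} \<and> i \<in> {1..m} \<and> W j $$ (i, l) > 0" if "(l, i) \<in> Ec" for i l
      using Wj[of i l] that Ec by (auto split: if_splits)
    show "W j $$ (j, 0) > 0" using Wj[of j 0] j by auto
    show "(j, i) \<in> Ec\<^sup>*" if "i \<in> {1..m}" for i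
      using sc j that by (auto simp: strongly_connected_on_def)
    show "W j $$ (i, 0) * v i + (\<Sum>l\<in>{1..m}. W j $$ (i, l) * (v i - v l)) = \<nu> * v i"
      if "i \<in> {1..m}" for i
    proof -
      define q where "q = i - 1"
      have q: "i = Suc q" "q < m" using that by (auto simp: q_def)
      have "(grounded_laplacian m (W j) *\<^sub>v u) $ q = \<nu> * u $ q"
        using Lu u q by simp
      then have "(\<Sum>l<m. grounded_laplacian m (W j) $$ (q, l) * v (Suc l)) = \<nu> * v (Suc q)"
        using mult_mat_vec_index_sum[OF grounded_laplacian_carrier u(1) q(2)] by (simp add: v_def)
      then show ?thesis unfolding q using grounded_laplacian_sum[OF q(2)] by simp
    qed
    have "\<exists>q<m. u $ q \<noteq> 0" using u by (auto simp: vec_eq_iff)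
    then obtain q where "q < m" "u $ q \<noteq> 0" by blast
    then show "\<exists>i\<in>{1..m}. v i \<noteq> 0" by (intro bexI[of _ "Suc q"]) (auto simp: v_def)
  qed (use j in auto)
qed

text \<open>Both spectra are finite, so the ratios Re \<alpha> / Re \<beta> are bounded above, and
  every gain beyond such a bound works because Re \<beta> is positive.\<close>

lemma dominating_gain_exists:
  assumes "(D :: complex mat) \<in> carrier_mat N N" "(L :: complex mat) \<in> carrier_mat M M"
    and pos: "\<And>\<beta>. eigenvalue L \<beta> \<Longrightarrow> Re \<beta> > 0"
  shows "\<exists>c. \<forall>\<mu>>c. \<forall>\<alpha> \<beta>. eigenvalue D \<alpha> \<longrightarrow> eigenvalue L \<beta> \<longrightarrow> Re \<alpha> < \<mu> * Re \<beta>"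
proof -
  have "finite (spectrum D)" "finite (spectrum L)" using assms card_finite_spectrum by auto
  then have "finite ((\<lambda>(\<alpha>, \<beta>). Re \<alpha> / Re \<beta>) ` (spectrum D \<times> spectrum L))" by auto
  from bdd_above_finite[OF this] obtain c
    where c: "\<And>x. x \<in> (\<lambda>(\<alpha>, \<beta>). Re \<alpha> / Re \<beta>) ` (spectrum D \<times> spectrum L) \<Longrightarrow> x \<le> c"
    unfolding bdd_above_def by blast
  have "Re \<alpha> < \<mu> * Re \<beta>" if "\<mu> > c" "eigenvalue D \<alpha>" "eigenvalue L \<beta>" for \<mu> \<alpha> \<beta>
  proof -
    have "Re \<alpha> / Re \<beta> \<le> c" using that by (intro c) (auto simp: spectrum_def)
    with that pos[of \<beta>] show ?thesis by (smt (verit) pos_divide_less_eq)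
  qed
  then show ?thesis by blast
qed

section \<open>Linear integral equations\<close>

lemma continuous_on_atLeast_realI:
  fixes g :: "real \<Rightarrow> 'a::topological_space"
  assumes "\<And>T. continuous_on {a..T} g"
  shows "continuous_on {a..} g"
  unfolding continuous_on_eq_continuous_within
proof
  fix x assume x: "x \<in> {a..}"
  have "continuous (at x within {a..x + 1}) g"
    using assms[of "x + 1"] x by (auto simp: continuous_on_eq_continuous_within)
  moreover have "at x within {a..} = at x within {a..x + 1}"
    by (rule at_within_nhd[of _ "{..<x + 1}"]) auto
  ultimately show "continuous (at x within {a..}) g" by simp
qed

lemma continuous_on_indefinite_integral:
  fixes g :: "real \<Rightarrow> real"
  assumes "\<And>T. g integrable_on {0..T}"
  shows "continuous_on {0..} (\<lambda>t. integral {0..t} g)"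
  by (intro continuous_on_atLeast_realI indefinite_integral_continuous_1 assms)

text \<open>Neumann series: \<open>s k\<close> is the k-th iterate of the integral operator applied
  to \<open>f\<close>. Repeated integration gives the bound C (c t)^k / k!, which is summable for
  every t. The solution is thus obtained on the whole half-line at once, without gluing short-time
  solutions.\<close>

lemma volterra_solvable:
  fixes M :: "'a \<Rightarrow> 'a \<Rightarrow> real" and f :: "'a \<Rightarrow> real \<Rightarrow> real"
  assumes fin: "finite K" and f: "\<And>a. a \<in> K \<Longrightarrow> continuous_on {0..} (f a)"
  obtains z where "\<And>a. a \<in> K \<Longrightarrow> continuous_on {0..} (z a)"
    "\<And>a t. a \<in> K \<Longrightarrow> t \<ge> 0 \<Longrightarrow> z a t = f a t + (\<Sum>b\<in>K. M a b * integral {0..t} (z b))"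
proof -
  define s where "s k = ((\<lambda>g a t. \<Sum>b\<in>K. M a b * integral {0..t} (g b)) ^^ k) f" for k
  have s0: "s 0 = f" and sSuc: "s (Suc k) a t = (\<Sum>b\<in>K. M a b * integral {0..t} (s k b))" for k a t
    by (simp_all add: s_def)
  have integ: "g integrable_on {0..T}" if "continuous_on {0..} g" for g :: "real \<Rightarrow> real" and T
    using that by (intro integrable_continuous_real) (auto elim: continuous_on_subset)
  have cont: "continuous_on {0..} (s k a)" if "a \<in> K" for k a
    using that
  proof (induction k arbitrary: a)
    case 0
    then show ?case using f by (simp add: s0)
  next
    case (Suc k)
    have "continuous_on {0..} (\<lambda>t. \<Sum>b\<in>K. M a b * integral {0..t} (s k b))"
      by (intro continuous_on_sum continuous_on_mult_left continuous_on_indefinite_integral integ Suc.IH)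
    then show ?case using sSuc[of k a] by presburger
  qed
  \<comment> \<open>Bounds the absolute row sums of all rows simultaneously, so that one estimate
    serves every component in the induction on k.\<close>
  define c where "c = (\<Sum>a\<in>K. \<Sum>b\<in>K. \<bar>M a b\<bar>)"
  have c0: "c \<ge> 0" unfolding c_def by (intro sum_nonneg) auto
  have rowc: "(\<Sum>b\<in>K. \<bar>M a b\<bar>) \<le> c" if "a \<in> K" for a
    unfolding c_def using that fin by (intro member_le_sum) (auto intro: sum_nonneg)
  define z where "z a t = (\<Sum>k. s k a t)" for a t
  have ulim: "uniform_limit {0..T} (\<lambda>n t. \<Sum>k<n. s k a t) (z a) sequentially"
    and sums: "\<And>t. t \<in> {0..T} \<Longrightarrow> (\<lambda>k. s k a t) sums z a t"
    if a: "a \<in> K" for a T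
  proof -
    have "\<exists>C. \<forall>t\<in>{0..T}. \<bar>f a t\<bar> \<le> C" if "a \<in> K" for a
    proof -
      have "compact (f a ` {0..T})"
        by (intro compact_continuous_image) (auto intro: continuous_on_subset[OF f[OF that]])
      then have "bounded (f a ` {0..T})" by (rule compact_imp_bounded)
      then show ?thesis unfolding bounded_iff by auto
    qed
    then obtain Ca where Ca: "\<And>a t. a \<in> K \<Longrightarrow> t \<in> {0..T} \<Longrightarrow> \<bar>f a t\<bar> \<le> Ca a" by metis
    define C where "C = (\<Sum>a\<in>K. \<bar>Ca a\<bar>)"
    have CaC: "\<bar>Ca a\<bar> \<le> C" if "a \<in> K" for a
      unfolding C_def using that fin by (intro member_le_sum) auto
    have C: "\<bar>f a t\<bar> \<le> C" if "a \<in> K" "t \<in> {0..T}" for a t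
      using Ca[OF that] CaC[OF that(1)] by linarith
    have C0: "C \<ge> 0" unfolding C_def by (intro sum_nonneg) auto
    have bound: "\<bar>s k a t\<bar> \<le> C * (c * t) ^ k / fact k" if "a \<in> K" "t \<in> {0..T}" for k a t
      using that
    proof (induction k arbitrary: a t)
      case 0
      then show ?case using C by (simp add: s0)
    next
      case (Suc k)
      have I: "\<bar>integral {0..t} (s k b)\<bar> \<le> C * c ^ k * t ^ Suc k / fact (Suc k)" if b: "b \<in> K" for b
      proof -
        have "((\<lambda>x. x ^ Suc k / Suc k) has_vector_derivative x ^ k) (at x within {0..t})" for x :: real
          using DERIV_cdivide[OF DERIV_pow[of "Suc k" x "{0..t}"], of "real (Suc k)"]
          by (simp add: has_real_derivative_iff_has_vector_derivative[symmetric] del: of_nat_Suc)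
        then have "((\<lambda>x. x ^ k) has_integral (t ^ Suc k / Suc k - 0 ^ Suc k / Suc k)) {0..t}"
          using Suc.prems by (intro fundamental_theorem_of_calculus) auto
        from has_integral_mult_right[OF this, of "C * c ^ k / fact k"]
        have hi: "((\<lambda>x. C * c ^ k / fact k * x ^ k) has_integral (C * c ^ k * t ^ Suc k / fact (Suc k))) {0..t}"
          by (simp add: field_simps)
        have "norm (integral {0..t} (s k b)) \<le> integral {0..t} (\<lambda>x. C * c ^ k / fact k * x ^ k)"
          using hi Suc.prems Suc.IH[OF b] b
          by (intro integral_norm_bound_integral integ cont)
            (auto simp: has_integral_iff power_mult_distrib mult_ac intro!: continuous_intros)
        then show ?thesis using hi by (simp add: has_integral_iff)
      qed
      have "\<bar>s (Suc k) a t\<bar> \<le> (\<Sum>b\<in>K. \<bar>M a b\<bar> * (C * c ^ k * t ^ Suc k / fact (Suc k)))"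
        unfolding sSuc by (rule order_trans[OF sum_abs], unfold abs_mult)
          (intro sum_mono mult_left_mono I abs_ge_zero)
      also have "\<dots> = (\<Sum>b\<in>K. \<bar>M a b\<bar>) * (C * c ^ k * t ^ Suc k / fact (Suc k))"
        by (simp only: sum_distrib_right)
      also have "\<dots> \<le> c * (C * c ^ k * t ^ Suc k / fact (Suc k))"
        using Suc.prems C0 c0 rowc by (intro mult_right_mono divide_nonneg_nonneg mult_nonneg_nonneg) auto
      also have "\<dots> = C * (c * t) ^ Suc k / fact (Suc k)"
        by (simp add: power_mult_distrib)
      finally show ?case .
    qed
    have bd: "norm (s k a t) \<le> C * ((c * T) ^ k / fact k)" if "t \<in> {0..T}" for k t
    proof -
      have "C * (c * t) ^ k / fact k \<le> C * (c * T) ^ k / fact k"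
        using C0 c0 that by (intro divide_right_mono mult_left_mono power_mono) auto
      then show ?thesis using bound[OF a that, of k] by simp
    qed
    have summ: "summable (\<lambda>k. C * ((c * T) ^ k / fact k))"
      using summable_exp[of "c * T"] by (intro summable_mult) (simp add: field_simps)
    show "uniform_limit {0..T} (\<lambda>n t. \<Sum>k<n. s k a t) (z a) sequentially"
      unfolding z_def by (rule Weierstrass_m_test[OF bd summ])
    show "(\<lambda>k. s k a t) sums z a t" if "t \<in> {0..T}" for t
      unfolding z_def by (intro summable_sums summable_comparison_test'[OF summ, of 0] bd[OF that])
  qed
  have contT: "continuous_on {0..T} (s k a)" if "a \<in> K" for k a T
    using cont[OF that] by (rule continuous_on_subset) auto
  have zc: "continuous_on {0..} (z a)" if "a \<in> K" for a
    by (rule continuous_on_atLeast_realI, rule uniform_limit_theorem[OF _ ulim[OF that]])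
      (auto intro!: always_eventually continuous_on_sum contT that)
  \<comment> \<open>Uniform convergence allows integration term by term. The integrated series is
    the original one shifted by one index, that is, without its first term \<open>f\<close>.\<close>
  have int_sums: "(\<lambda>k. integral {0..t} (s k b)) sums integral {0..t} (z b)" if b: "b \<in> K" for b t
  proof -
    obtain I J where "\<And>n. ((\<lambda>t. \<Sum>k<n. s k b t) has_integral I n) {0..t}"
      "(z b has_integral J) {0..t}" "I \<longlonglongrightarrow> J"
      by (rule uniform_limit_integral[OF ulim[OF b, of t]]) (auto intro!: continuous_on_sum contT b)
    moreover have "((\<lambda>t. \<Sum>k<n. s k b t) has_integral (\<Sum>k<n. integral {0..t} (s k b))) {0..t}" for n
      by (intro has_integral_sum) (auto intro!: integrable_integral integ cont b)
    ultimately have "I = (\<lambda>n. \<Sum>k<n. integral {0..t} (s k b))" "J = integral {0..t} (z b)"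
      by (auto intro: has_integral_unique simp: integral_unique)
    with \<open>I \<longlonglongrightarrow> J\<close> show ?thesis by (simp add: sums_def)
  qed
  have "z a t = f a t + (\<Sum>b\<in>K. M a b * integral {0..t} (z b))" if a: "a \<in> K" and t: "t \<ge> 0" for a t
  proof -
    have "(\<lambda>k. s (Suc k) a t) sums (\<Sum>b\<in>K. M a b * integral {0..t} (z b))"
      unfolding sSuc by (intro sums_sum sums_mult int_sums)
    from sums_Suc[OF this] have "(\<lambda>k. s k a t) sums ((\<Sum>b\<in>K. M a b * integral {0..t} (z b)) + f a t)"
      by (simp add: s0)
    with sums[OF a, of t t] t show ?thesis using sums_unique2 by fastforce
  qed
  with zc show thesis by (rule that)
qed

text \<open>The right-hand side \<open>g\<close> of the known solution \<open>x\<close> may contain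
  a discontinuous input. Subtracting its integral leaves a condition on the difference alone, in
  which only \<open>h\<close> is integrated. Both directions are wanted: one derives the error
  equation, the other builds observer trajectories from errors.\<close>

lemma solves_iff_diff:
  assumes x: "solves d x g" and z: "\<And>t. t \<ge> 0 \<Longrightarrow> z t \<in> carrier_vec d"
    and fg: "\<And>s r. s \<ge> 0 \<Longrightarrow> r < d \<Longrightarrow> f s $ r - g s $ r = h r s"
  shows "solves d z f \<longleftrightarrow> (\<forall>r<d. \<forall>t\<ge>0.
    (h r has_integral (z t $ r - x t $ r - (z 0 $ r - x 0 $ r))) {0..t})"
proof -
  have "((\<lambda>s. f s $ r) has_integral (z t $ r - z 0 $ r)) {0..t} \<longleftrightarrow>
    (h r has_integral (z t $ r - x t $ r - (z 0 $ r - x 0 $ r))) {0..t}" (is "?F \<longleftrightarrow> ?H")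
    if "r < d" "t \<ge> 0" for r t
  proof -
    have G: "((\<lambda>s. g s $ r) has_integral (x t $ r - x 0 $ r)) {0..t}"
      using x that by (auto simp: solves_def)
    have "?F \<longleftrightarrow> ((\<lambda>s. h r s + g s $ r) has_integral (z t $ r - z 0 $ r)) {0..t}"
      using fg that by (intro has_integral_cong) (auto simp: algebra_simps)
    also have "\<dots> \<longleftrightarrow> ?H"
    proof
      assume "((\<lambda>s. h r s + g s $ r) has_integral (z t $ r - z 0 $ r)) {0..t}"
      from has_integral_diff[OF this G] show ?H by (simp add: algebra_simps)
    next
      assume ?H
      from has_integral_add[OF this G]
      show "((\<lambda>s. h r s + g s $ r) has_integral (z t $ r - z 0 $ r)) {0..t}"
        by (simp add: algebra_simps)
    qed
    finally show ?thesis .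
  qed
  then show ?thesis using z unfolding solves_def by blast
qed

lemma continuous_on_primitive:
  fixes y g :: "real \<Rightarrow> real"
  assumes "\<And>t. t \<ge> 0 \<Longrightarrow> (g has_integral (y t - y 0)) {0..t}"
  shows "continuous_on {0..} y"
proof -
  have "g integrable_on {0..T}" for T using assms[of T] by (cases "T \<ge> 0") auto
  then have "continuous_on {0..} (\<lambda>t. y 0 + integral {0..t} g)"
    by (intro continuous_on_add continuous_on_const continuous_on_indefinite_integral)
  then show ?thesis
  proof (rule continuous_on_eq)
    show "y 0 + integral {0..t} g = y t" if "t \<in> {0..}" for t
      using integral_unique[OF assms[of t]] that by simp
  qed
qed

lemma has_vector_derivative_primitive:
  fixes y g :: "real \<Rightarrow> real"
  assumes int: "\<And>t. t \<ge> 0 \<Longrightarrow> (g has_integral (y t - y 0)) {0..t}"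
    and g: "continuous_on {0..} g" and t: "t > 0"
  shows "(y has_vector_derivative g t) (at t)"
proof -
  have "((\<lambda>u. integral {0..u} g) has_vector_derivative g t) (at t within {0..t + 1})"
    using t by (intro integral_has_vector_derivative continuous_on_subset[OF g]) auto
  then have "((\<lambda>u. integral {0..u} g) has_vector_derivative g t) (at t)"
    using t by (simp add: at_within_Icc_at)
  then have "((\<lambda>u. y 0 + integral {0..u} g) has_vector_derivative g t) (at t)"
    using has_vector_derivative_add[OF has_vector_derivative_const[of "y 0" "at t"]] by simp
  then show ?thesis
  proof (rule has_vector_derivative_transform_within_open[of _ _ _ "{0<..}"])
    show "y 0 + integral {0..u} g = y u" if "u \<in> {0<..}" for u
      using integral_unique[OF int[of u]] that by simp
  qed (use t in auto)
qed

section \<open>Block sums and norms of stacked vectors\<close>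

lemma vsum_index:
  assumes "finite S" "r < d" "\<And>l. l \<in> S \<Longrightarrow> f l \<in> carrier_vec d"
  shows "vsum d f S $ r = (\<Sum>l\<in>S. f l $ r)"
  using assms by (intro index_finsum_vec) auto

lemma vsum_carrier:
  assumes "\<And>l. l \<in> S \<Longrightarrow> f l \<in> carrier_vec d"
  shows "vsum d f S \<in> carrier_vec d"
  using assms by (intro finsum_vec_closed) auto

text \<open>Stated for an arbitrary list of blocks to make the induction possible. The equality of
  dimensions is carried along because subtraction splits over appended vectors only when the blocks
  match.\<close>

lemma stack_diff_norm:
  fixes v w :: "nat \<Rightarrow> real vec"
  assumes "\<And>j. j \<in> set js \<Longrightarrow> v j \<in> carrier_vec (n j)" "\<And>j. j \<in> set js \<Longrightarrow> w j \<in> carrier_vec (n j)"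
  shows "let V = foldr (\<lambda>j z. v j @\<^sub>v z) js (0\<^sub>v 0); W = foldr (\<lambda>j z. w j @\<^sub>v z) js (0\<^sub>v 0) in
     dim_vec V = dim_vec W \<and>
     (V - W) \<bullet> (V - W) = (\<Sum>j\<leftarrow>js. \<Sum>r<n j. (v j $ r - w j $ r)\<^sup>2)"
  using assms
proof (induction js)
  case Nil
  then show ?case by (simp add: scalar_prod_def)
next
  case (Cons a js)
  define V where "V = foldr (\<lambda>j z. v j @\<^sub>v z) js (0\<^sub>v 0)"
  define W where "W = foldr (\<lambda>j z. w j @\<^sub>v z) js (0\<^sub>v 0)"
  have IH: "dim_vec V = dim_vec W" "(V - W) \<bullet> (V - W) = (\<Sum>j\<leftarrow>js. \<Sum>r<n j. (v j $ r - w j $ r)\<^sup>2)"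
    using Cons unfolding V_def W_def by (auto simp: Let_def)
  have c: "v a \<in> carrier_vec (n a)" "w a \<in> carrier_vec (n a)" using Cons.prems by auto
  have split: "(v a @\<^sub>v V) - (w a @\<^sub>v W) = (v a - w a) @\<^sub>v (V - W)"
    using c IH(1) by (intro eq_vecI) auto
  have "((v a - w a) @\<^sub>v (V - W)) \<bullet> ((v a - w a) @\<^sub>v (V - W)) = (v a - w a) \<bullet> (v a - w a) + (V - W) \<bullet> (V - W)"
    using c by (intro scalar_prod_append[of _ "n a" _ "dim_vec W"]) (auto intro: carrier_vecI)
  moreover have "(v a - w a) \<bullet> (v a - w a) = (\<Sum>r = 0..<n a. (v a $ r - w a $ r) * (v a $ r - w a $ r))"
    using c by (auto simp: scalar_prod_def)
  then have "(v a - w a) \<bullet> (v a - w a) = (\<Sum>r<n a. (v a $ r - w a $ r)\<^sup>2)"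
    by (simp only: lessThan_atLeast0 power2_eq_square)
  moreover have "foldr (\<lambda>j z. v j @\<^sub>v z) (a # js) (0\<^sub>v 0) = v a @\<^sub>v V"
    "foldr (\<lambda>j z. w j @\<^sub>v z) (a # js) (0\<^sub>v 0) = w a @\<^sub>v W"
    by (simp_all add: V_def W_def)
  ultimately show ?case
    unfolding Let_def split using c IH by (simp add: split)
qed

lemma vnorm_stack_diff:
  fixes v w :: "nat \<Rightarrow> real vec"
  assumes "\<And>j. j \<in> {1..m} \<Longrightarrow> v j \<in> carrier_vec (n j)" "\<And>j. j \<in> {1..m} \<Longrightarrow> w j \<in> carrier_vec (n j)"
  shows "vnorm (stack m v - stack m w) = sqrt (\<Sum>j\<in>{1..m}. \<Sum>r<n j. (v j $ r - w j $ r)\<^sup>2)"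
proof -
  have "set [1..<Suc m] = {1..m}" by auto
  then show ?thesis
    using stack_diff_norm[of "[1..<Suc m]" v n w] assms
    by (simp add: vnorm_def stack_def Let_def sum_list_distinct_conv_sum_set del: upt_Suc)
qed

lemma vnorm_stack_tendsto_iff:
  fixes v w :: "nat \<Rightarrow> real \<Rightarrow> real vec"
  assumes v: "\<And>j t. j \<in> {1..m} \<Longrightarrow> t \<ge> 0 \<Longrightarrow> v j t \<in> carrier_vec (n j)"
    and w: "\<And>j t. j \<in> {1..m} \<Longrightarrow> t \<ge> 0 \<Longrightarrow> w j t \<in> carrier_vec (n j)"
  shows "((\<lambda>t. vnorm (stack m (\<lambda>j. v j t) - stack m (\<lambda>j. w j t))) \<longlongrightarrow> 0) at_top \<longleftrightarrow>
    (\<forall>j\<in>{1..m}. \<forall>r<n j. ((\<lambda>t. v j t $ r - w j t $ r) \<longlongrightarrow> 0) at_top)"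
proof -
  define f where "f t = sqrt (\<Sum>j\<in>{1..m}. \<Sum>r<n j. (v j t $ r - w j t $ r)\<^sup>2)" for t
  \<comment> \<open>The blocks have their proper dimensions at times \<open>t \<ge> 0\<close> only,
    so the norm formula holds eventually rather than everywhere.\<close>
  have ev: "\<forall>\<^sub>F t in at_top. vnorm (stack m (\<lambda>j. v j t) - stack m (\<lambda>j. w j t)) = f t"
    using eventually_ge_at_top[of "0::real"]
    by eventually_elim (use v w vnorm_stack_diff[of m _ n] in \<open>simp add: f_def\<close>)
  have "(f \<longlongrightarrow> 0) at_top \<longleftrightarrow> (\<forall>j\<in>{1..m}. \<forall>r<n j. ((\<lambda>t. v j t $ r - w j t $ r) \<longlongrightarrow> 0) at_top)"
  proof safe
    fix j r assume f: "(f \<longlongrightarrow> 0) at_top" and j: "j \<in> {1..m}" and r: "r < n j"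
    have "norm (v j t $ r - w j t $ r) \<le> f t" for t
    proof -
      have "(v j t $ r - w j t $ r)\<^sup>2 \<le> (\<Sum>r<n j. (v j t $ r - w j t $ r)\<^sup>2)"
        using r by (intro member_le_sum[of r "{..<n j}" "\<lambda>r. (v j t $ r - w j t $ r)\<^sup>2"]) auto
      also have "\<dots> \<le> (\<Sum>j\<in>{1..m}. \<Sum>r<n j. (v j t $ r - w j t $ r)\<^sup>2)"
        using j by (intro member_le_sum[of j "{1..m}" "\<lambda>j. \<Sum>r<n j. (v j t $ r - w j t $ r)\<^sup>2"])
          (auto intro: sum_nonneg)
      finally show ?thesis unfolding f_def by (simp add: real_le_rsqrt)
    qed
    then show "((\<lambda>t. v j t $ r - w j t $ r) \<longlongrightarrow> 0) at_top"
      by (intro Lim_null_comparison[OF _ f] always_eventually) auto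
  next
    assume "\<forall>j\<in>{1..m}. \<forall>r<n j. ((\<lambda>t. v j t $ r - w j t $ r) \<longlongrightarrow> 0) at_top"
    then have "((\<lambda>t. sqrt (\<Sum>j\<in>{1..m}. \<Sum>r<n j. (v j t $ r - w j t $ r)\<^sup>2))
      \<longlongrightarrow> sqrt (\<Sum>j\<in>{1..m}. \<Sum>r<n j. 0\<^sup>2)) at_top"
      by (intro tendsto_intros) auto
    then show "(f \<longlongrightarrow> 0) at_top" by (simp add: f_def[abs_def])
  qed
  then show ?thesis using tendsto_cong[OF ev] by simp
qed

section \<open>Bounded inputs, unstable free motions and ranks from orderings\<close>

lemma abs_index_le_vnorm:
  assumes "r < dim_vec v"
  shows "\<bar>v $ r\<bar> \<le> vnorm v"
proof -
  have "(v $ r)\<^sup>2 \<le> (\<Sum>i = 0..<dim_vec v. v $ i * v $ i)"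
    using assms member_le_sum[of r "{0..<dim_vec v}" "\<lambda>i. v $ i * v $ i"]
    by (simp add: power2_eq_square)
  then show ?thesis by (simp add: vnorm_def scalar_prod_def real_le_rsqrt)
qed

lemma bounded_signal_integrable:
  assumes v: "bounded_signal d v" and r: "r < d"
  shows "(\<lambda>t. v t $ r) integrable_on {0..T}"
proof -
  from v obtain M where M: "\<And>t. t \<ge> 0 \<Longrightarrow> vnorm (v t) \<le> M" and c: "\<And>t. t \<ge> 0 \<Longrightarrow> v t \<in> carrier_vec d"
    unfolding bounded_signal_def by auto
  show ?thesis
  proof (rule measurable_bounded_by_integrable_imp_integrable)
    show "(\<lambda>t. v t $ r) \<in> borel_measurable (lebesgue_on {0..T})"
      by (rule measurable_restrict_mono[where A = "{0..}"]) (use v r in \<open>auto simp: bounded_signal_def\<close>)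
    show "(\<lambda>_. M) integrable_on {0..T}" by (intro integrable_continuous_real continuous_on_const)
    fix t assume "t \<in> {0..T}"
    then show "norm (v t $ r) \<le> M"
      using abs_index_le_vnorm[of r "v t"] M[of t] c[of t] r by auto
  qed simp
qed

text \<open>Some eigenvalue \<alpha> has Re \<alpha> \<ge> 0. With an eigenvector v, the complex
  solution exp (t \<alpha>) v does not tend to zero in any component where v is nonzero, so its real
  or its imaginary part is a real solution with the same defect.\<close>

lemma unstable_mode:
  assumes M: "M \<in> carrier_mat N N" and nh: "\<not> hurwitz M"
  obtains \<xi> :: "nat \<Rightarrow> real \<Rightarrow> real" and r where "r < N" "\<not> (\<xi> r \<longlongrightarrow> 0) at_top"
    "\<And>r. continuous_on {0..} (\<xi> r)"
    "\<And>r t. r < N \<Longrightarrow> t \<ge> 0 \<Longrightarrow> ((\<lambda>s. \<Sum>q<N. M $$ (r, q) * \<xi> q s) has_integral (\<xi> r t - \<xi> r 0)) {0..t}"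
proof -
  note mode = that
  let ?M = "map_mat complex_of_real M"
  have cM: "?M \<in> carrier_mat N N" using M by simp
  from nh obtain \<alpha> where "eigenvalue ?M \<alpha>" and Re: "Re \<alpha> \<ge> 0" by (auto simp: hurwitz_def not_less)
  then obtain v where v: "v \<in> carrier_vec N" "v \<noteq> 0\<^sub>v N" and eig: "?M *\<^sub>v v = \<alpha> \<cdot>\<^sub>v v"
    unfolding eigenvalue_def eigenvector_def using M by auto
  from v obtain r0 where r0: "r0 < N" "v $ r0 \<noteq> 0" by (auto simp: vec_eq_iff)
  define w where "w r t = exp (complex_of_real t * \<alpha>) * v $ r" for r t
  have dw: "(w r has_vector_derivative (\<Sum>q<N. M $$ (r, q) * w q t)) (at t within T)" if r: "r < N" for r t T
  proof -
    have "\<alpha> * v $ r = (\<Sum>q<N. ?M $$ (r, q) * v $ q)"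
      using arg_cong[OF eig, of "\<lambda>u. u $ r"] mult_mat_vec_index_sum[OF cM v(1) r] v(1) r by simp
    also have "\<dots> = (\<Sum>q<N. M $$ (r, q) * v $ q)"
      using M r by (intro sum.cong) auto
    finally have "exp (complex_of_real t * \<alpha>) * (\<alpha> * v $ r)
      = exp (complex_of_real t * \<alpha>) * (\<Sum>q<N. M $$ (r, q) * v $ q)" by (rule arg_cong)
    then have eq: "exp (complex_of_real t * \<alpha>) * \<alpha> * v $ r = (\<Sum>q<N. M $$ (r, q) * w q t)"
      by (simp add: w_def sum_distrib_left mult.assoc mult.left_commute)
    have "((\<lambda>t. exp (complex_of_real t * \<alpha>) * v $ r) has_vector_derivative
        exp (complex_of_real t * \<alpha>) * \<alpha> * v $ r) (at t within T)"
      by (rule has_vector_derivative_real_field[where f = "\<lambda>z. exp (z * \<alpha>) * v $ r"])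
        (auto intro!: derivative_eq_intros)
    then show ?thesis unfolding eq by (simp add: w_def[abs_def])
  qed
  \<comment> \<open>Since M is real, a real-linear functional sends complex solutions to real ones.
    Stating this for a general \<open>L\<close> treats \<open>Re\<close> and \<open>Im\<close>
    together.\<close>
  have parts: thesis if L: "bounded_linear L" and Lm: "\<And>a z. L (complex_of_real a * z) = a * L z"
    and ntends: "\<not> ((\<lambda>t. L (w r0 t)) \<longlongrightarrow> 0) at_top" for L :: "complex \<Rightarrow> real"
  proof (rule mode[of r0 "\<lambda>r t. L (w r t)"])
    interpret L: bounded_linear L by (rule L)
    show "continuous_on {0..} (\<lambda>t. L (w r t))" for r
      unfolding w_def by (intro L.continuous_on continuous_intros)
    show "((\<lambda>s. \<Sum>q<N. M $$ (r, q) * L (w q s)) has_integral (L (w r t) - L (w r 0))) {0..t}"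
      if "r < N" "t \<ge> 0" for r t
    proof (rule fundamental_theorem_of_calculus[OF that(2)])
      fix s
      show "((\<lambda>t. L (w r t)) has_vector_derivative (\<Sum>q<N. M $$ (r, q) * L (w q s))) (at s within {0..t})"
        using L.has_vector_derivative[OF dw[OF that(1), of s "{0..t}"]] by (simp add: L.sum Lm)
    qed
  qed (use r0 ntends in auto)
  \<comment> \<open>If both parts vanished asymptotically, so would \<open>w r0\<close>; but its
    modulus never drops below that of \<open>v $ r0\<close> at times
    \<open>t \<ge> 0\<close>.\<close>
  have "\<not> ((\<lambda>t. Re (w r0 t)) \<longlongrightarrow> 0) at_top \<or> \<not> ((\<lambda>t. Im (w r0 t)) \<longlongrightarrow> 0) at_top"
  proof (rule ccontr)
    assume "\<not> ?thesis"
    then have "(w r0 \<longlongrightarrow> 0) at_top" by (subst tendsto_complex_iff) simp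
    from tendstoD[OF this, of "norm (v $ r0)"] r0
    have "\<forall>\<^sub>F t in at_top. norm (w r0 t) < norm (v $ r0)" by (simp add: dist_norm)
    from eventually_conj[OF this eventually_ge_at_top[of 0]]
    obtain t where t: "norm (w r0 t) < norm (v $ r0)" "t \<ge> 0"
      by (metis (no_types, lifting) eventually_at_top_linorder order_refl)
    have "norm (v $ r0) \<le> exp (t * Re \<alpha>) * norm (v $ r0)"
      using t(2) Re by (simp add: mult_le_cancel_right1)
    also have "\<dots> = norm (w r0 t)" by (simp add: w_def norm_mult)
    finally show False using t by simp
  qed
  then show thesis
    using parts[OF bounded_linear_Re] parts[OF bounded_linear_Im] by auto
qed

text \<open>The rank of a node is its position in the listing, which is unambiguous because the
  listing is distinct. It depends on \<open>xs\<close> alone, so a listing shared by two graphs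
  yields one rank for both.\<close>

lemma topological_ordering_rank:
  assumes "topological_ordering V E xs"
  shows "(a, b) \<in> E \<Longrightarrow> inv_into {..<length xs} ((!) xs) a < inv_into {..<length xs} ((!) xs) b"
proof -
  assume "(a, b) \<in> E"
  with assms obtain q r where qr: "q < r" "r < length xs" "xs ! q = a" "xs ! r = b"
    unfolding topological_ordering_def by fast
  have "inj_on ((!) xs) {..<length xs}"
    using assms by (simp add: topological_ordering_def inj_on_nth)
  then show ?thesis using qr by (metis inv_into_f_f lessThan_iff order_less_trans)
qed

section \<open>The error equation\<close>

locale observer_network =
  fixes m :: nat and n k p :: "nat \<Rightarrow> nat"
    and A C :: "nat \<Rightarrow> nat \<Rightarrow> real mat" and B F :: "nat \<Rightarrow> real mat"
    and Ec :: "(nat \<times> nat) set" and W :: "nat \<Rightarrow> real mat"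
  assumes A_carrier: "\<And>i j. i \<in> {1..m} \<Longrightarrow> j \<in> {1..m} \<Longrightarrow> A i j \<in> carrier_mat (n i) (n j)"
    and B_carrier: "\<And>i. i \<in> {1..m} \<Longrightarrow> B i \<in> carrier_mat (n i) (k i)"
    and C_carrier: "\<And>i j. i \<in> {1..m} \<Longrightarrow> j \<in> {1..m} \<Longrightarrow> C i j \<in> carrier_mat (p i) (n j)"
    and F_carrier: "\<And>i. i \<in> {1..m} \<Longrightarrow> F i \<in> carrier_mat (n i) (p i)"
    and Ec_subset: "Ec \<subseteq> {1..m} \<times> {1..m}" and Ec_irrefl: "\<And>i. (i, i) \<notin> Ec"
    and weights: "consensus_weights m Ec W"
begin

abbreviation NA :: "nat \<Rightarrow> nat set" where "NA \<equiv> in_nbrs (coupling_graph m A)"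
abbreviation NC :: "nat \<Rightarrow> nat set" where "NC \<equiv> in_nbrs (coupling_graph m C)"

lemma nbrs:
  "NA j \<subseteq> {1..m}" "NC j \<subseteq> {1..m}" "in_nbrs Ec j \<subseteq> {1..m}"
  "finite (NA j)" "finite (NC j)" "finite (in_nbrs Ec j)"
proof -
  show *: "NA j \<subseteq> {1..m}" "NC j \<subseteq> {1..m}" "in_nbrs Ec j \<subseteq> {1..m}"
    using Ec_subset by (auto simp: in_nbrs_def coupling_graph_def)
  show "finite (NA j)" "finite (NC j)" "finite (in_nbrs Ec j)"
    using * by (auto intro: finite_subset)
qed

text \<open>The error \<open>e i j\<close> belongs to agent i's estimate of \<open>x j\<close> if \<open>i \<ge> 1\<close>, and to the auxiliary
  variable of agent j if \<open>i = 0\<close>, so that the first index ranges over the nodes of the graphs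
  underlying the weights.\<close>

definition err_rhs :: "real \<Rightarrow> (nat \<Rightarrow> nat \<Rightarrow> nat \<Rightarrow> real) \<Rightarrow> nat \<Rightarrow> nat \<Rightarrow> nat \<Rightarrow> real" where
  "err_rhs \<mu> e i j r = (if i = 0 then
     (\<Sum>s<n j. A j j $$ (r, s) * e 0 j s) + (\<Sum>l\<in>NA j. \<Sum>s<n l. A j l $$ (r, s) * e j l s)
     - (\<Sum>q<p j. F j $$ (r, q) * ((\<Sum>s<n j. C j j $$ (q, s) * e 0 j s)
          + (\<Sum>l\<in>NC j. \<Sum>s<n l. C j l $$ (q, s) * e j l s)))
   else (\<Sum>s<n j. A j j $$ (r, s) * e i j s) + (\<Sum>l\<in>NA j. \<Sum>s<n l. A j l $$ (r, s) * e i l s)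
     + \<mu> * (\<Sum>l\<le>m. W j $$ (i, l) * (e l j r - e i j r)))"

definition err :: "(nat \<Rightarrow> real vec) \<Rightarrow> (nat \<Rightarrow> nat \<Rightarrow> real vec) \<Rightarrow> (nat \<Rightarrow> real vec)
    \<Rightarrow> nat \<Rightarrow> nat \<Rightarrow> nat \<Rightarrow> real" where
  "err x xh xb i j r = (if i = 0 then xb j $ r - x j $ r else xh i j $ r - x j $ r)"

lemma weight_cases:
  assumes "j \<in> {1..m}" "s \<le> m" "r \<le> m"
  shows "if (r, s) \<in> Ec \<union> {(0, j)} then W j $$ (s, r) > 0 else W j $$ (s, r) = 0"
  using weights assms unfolding consensus_weights_def by simp

text \<open>Node 0 is not an agent, so the only edge leaving it in the graph belonging to
  \<open>x j\<close> is the one to j.\<close>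

lemma weight_zero:
  assumes j: "j \<in> {1..m}" and i: "i \<in> {1..m}"
  shows "i \<noteq> j \<Longrightarrow> W j $$ (i, 0) = 0" "l \<in> {1..m} \<Longrightarrow> l \<notin> in_nbrs Ec i \<Longrightarrow> W j $$ (i, l) = 0"
proof -
  have "(0, i) \<notin> Ec" using Ec_subset by auto
  then show "i \<noteq> j \<Longrightarrow> W j $$ (i, 0) = 0" using weight_cases[of j i 0] i j by simp
  assume l: "l \<in> {1..m}" "l \<notin> in_nbrs Ec i"
  then have "(l, i) \<notin> Ec" using Ec_irrefl by (auto simp: in_nbrs_def)
  then show "W j $$ (i, l) = 0" using weight_cases[of j i l] i j l by simp
qed

text \<open>Allows the coupling to be written as one sum over all nodes: the reference term
  disappears for every agent but j, so a single formula covers an agent's estimate of its own state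
  and its estimates of the other states.\<close>

lemma consensus_sum:
  assumes "j \<in> {1..m}" "i \<in> {1..m}"
  shows "(\<Sum>l\<le>m. W j $$ (i, l) * f l)
    = W j $$ (i, 0) * f 0 + (\<Sum>l\<in>in_nbrs Ec i. W j $$ (i, l) * f l)"
proof -
  have "(\<Sum>l\<le>m. W j $$ (i, l) * f l) = W j $$ (i, 0) * f 0 + (\<Sum>l\<in>{1..m}. W j $$ (i, l) * f l)"
    by (simp add: sum.atMost_shift sum.atLeast1_atMost_eq)
  also have "(\<Sum>l\<in>{1..m}. W j $$ (i, l) * f l) = (\<Sum>l\<in>in_nbrs Ec i. W j $$ (i, l) * f l)"
    using nbrs weight_zero[OF assms] by (intro sum.mono_neutral_right) auto
  finally show ?thesis .
qed

text \<open>Vector algebra at a frozen instant: the variables are values of the signals at one time,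
  so the dimension hypotheses can be supplied separately for each \<open>t \<ge> 0\<close>.\<close>

context
  fixes x u xb :: "nat \<Rightarrow> real vec" and xh :: "nat \<Rightarrow> nat \<Rightarrow> real vec"
  assumes x: "\<And>j. j \<in> {1..m} \<Longrightarrow> x j \<in> carrier_vec (n j)"
    and u: "\<And>j. j \<in> {1..m} \<Longrightarrow> u j \<in> carrier_vec (k j)"
    and xb: "\<And>j. j \<in> {1..m} \<Longrightarrow> xb j \<in> carrier_vec (n j)"
    and xh: "\<And>i j. i \<in> {1..m} \<Longrightarrow> j \<in> {1..m} \<Longrightarrow> xh i j \<in> carrier_vec (n j)"
begin

lemma block_vsum:
  assumes "S \<subseteq> {1..m}" "\<And>l. l \<in> S \<Longrightarrow> M l \<in> carrier_mat d (n l)"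
    "\<And>l. l \<in> S \<Longrightarrow> v l \<in> carrier_vec (n l)"
  shows "r < d \<Longrightarrow> vsum d (\<lambda>l. M l *\<^sub>v v l) S $ r = (\<Sum>l\<in>S. \<Sum>s<n l. M l $$ (r, s) * v l $ s)"
    and "vsum d (\<lambda>l. M l *\<^sub>v v l) S \<in> carrier_vec d"
proof -
  have fin: "finite S" using assms(1) finite_subset by blast
  show "vsum d (\<lambda>l. M l *\<^sub>v v l) S $ r = (\<Sum>l\<in>S. \<Sum>s<n l. M l $$ (r, s) * v l $ s)" if "r < d"
  proof -
    have "vsum d (\<lambda>l. M l *\<^sub>v v l) S $ r = (\<Sum>l\<in>S. (M l *\<^sub>v v l) $ r)"
      using assms(2,3) by (intro vsum_index fin that) (meson mult_mat_vec_carrier)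
    then show ?thesis using mult_mat_vec_index_sum[OF assms(2,3) that] by simp
  qed
  show "vsum d (\<lambda>l. M l *\<^sub>v v l) S \<in> carrier_vec d"
    using assms(2,3) by (intro vsum_carrier) (meson mult_mat_vec_carrier)
qed

lemma system_rhs_index:
  assumes j: "j \<in> {1..m}" and r: "r < n j"
  shows "(A j j *\<^sub>v x j + vsum (n j) (\<lambda>l. A j l *\<^sub>v x l) (NA j) + B j *\<^sub>v u j) $ r
    = (\<Sum>s<n j. A j j $$ (r, s) * x j $ s) + (\<Sum>l\<in>NA j. \<Sum>s<n l. A j l $$ (r, s) * x l $ s)
      + (B j *\<^sub>v u j) $ r"
proof -
  have "vsum (n j) (\<lambda>l. A j l *\<^sub>v x l) (NA j) $ r = (\<Sum>l\<in>NA j. \<Sum>s<n l. A j l $$ (r, s) * x l $ s)"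
    and "vsum (n j) (\<lambda>l. A j l *\<^sub>v x l) (NA j) \<in> carrier_vec (n j)"
    using nbrs[of j] A_carrier x j r by (intro block_vsum; blast)+
  then show ?thesis
    using mult_mat_vec_index_sum[OF A_carrier[OF j j] x[OF j] r] B_carrier[OF j] r by simp
qed

lemma estimate_rhs_index:
  assumes i: "i \<in> {1..m}" and j: "j \<in> {1..m}" and r: "r < n j"
    and z: "z \<in> carrier_vec (n j)" and w: "w \<in> carrier_vec (n j)"
  shows "(A j j *\<^sub>v z + B j *\<^sub>v u j + vsum (n j) (\<lambda>l. A j l *\<^sub>v xh i l) (NA j) + w) $ r
    = (\<Sum>s<n j. A j j $$ (r, s) * z $ s) + (\<Sum>l\<in>NA j. \<Sum>s<n l. A j l $$ (r, s) * xh i l $ s)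
      + (B j *\<^sub>v u j) $ r + w $ r"
proof -
  have "vsum (n j) (\<lambda>l. A j l *\<^sub>v xh i l) (NA j) $ r = (\<Sum>l\<in>NA j. \<Sum>s<n l. A j l $$ (r, s) * xh i l $ s)"
    and "vsum (n j) (\<lambda>l. A j l *\<^sub>v xh i l) (NA j) \<in> carrier_vec (n j)"
    using nbrs[of j] A_carrier xh i j r by (intro block_vsum; blast)+
  then show ?thesis
    using mult_mat_vec_index_sum[OF A_carrier[OF j j] z r] B_carrier[OF j] r w by simp
qed

lemma coupling_index:
  assumes i: "i \<in> {1..m}" and j: "j \<in> {1..m}" and r: "r < n j"
  shows "vsum (n j) (\<lambda>l. W j $$ (i, l) \<cdot>\<^sub>v (xh l j - xh i j)) (in_nbrs Ec i) \<in> carrier_vec (n j)"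
    "vsum (n j) (\<lambda>l. W j $$ (i, l) \<cdot>\<^sub>v (xh l j - xh i j)) (in_nbrs Ec i) $ r
     = (\<Sum>l\<in>in_nbrs Ec i. W j $$ (i, l) * (err x xh xb l j r - err x xh xb i j r))"
proof -
  have c: "W j $$ (i, l) \<cdot>\<^sub>v (xh l j - xh i j) \<in> carrier_vec (n j)" if "l \<in> in_nbrs Ec i" for l
    using nbrs(3)[of i] that xh i j by (intro smult_carrier_vec[THEN iffD2] minus_carrier_vec) auto
  show "vsum (n j) (\<lambda>l. W j $$ (i, l) \<cdot>\<^sub>v (xh l j - xh i j)) (in_nbrs Ec i) \<in> carrier_vec (n j)"
    using c by (intro vsum_carrier)
  have "vsum (n j) (\<lambda>l. W j $$ (i, l) \<cdot>\<^sub>v (xh l j - xh i j)) (in_nbrs Ec i) $ r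
     = (\<Sum>l\<in>in_nbrs Ec i. (W j $$ (i, l) \<cdot>\<^sub>v (xh l j - xh i j)) $ r)"
    using c nbrs r by (intro vsum_index)
  also have "\<dots> = (\<Sum>l\<in>in_nbrs Ec i. W j $$ (i, l) * (err x xh xb l j r - err x xh xb i j r))"
  proof (intro sum.cong refl)
    fix l assume "l \<in> in_nbrs Ec i"
    then have l: "l \<in> {1..m}" using nbrs(3)[of i] by auto
    then show "(W j $$ (i, l) \<cdot>\<^sub>v (xh l j - xh i j)) $ r = W j $$ (i, l) * (err x xh xb l j r - err x xh xb i j r)"
      using xh[OF l j] xh[OF i j] r i by (auto simp: err_def)
  qed
  finally show "vsum (n j) (\<lambda>l. W j $$ (i, l) \<cdot>\<^sub>v (xh l j - xh i j)) (in_nbrs Ec i) $ r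
     = (\<Sum>l\<in>in_nbrs Ec i. W j $$ (i, l) * (err x xh xb l j r - err x xh xb i j r))" .
qed

lemma estimate_error_other:
  assumes i: "i \<in> {1..m}" and j: "j \<in> {1..m}" and ij: "i \<noteq> j" and r: "r < n j"
  shows "(A j j *\<^sub>v xh i j + B j *\<^sub>v u j + vsum (n j) (\<lambda>l. A j l *\<^sub>v xh i l) (NA j)
        + \<mu> \<cdot>\<^sub>v vsum (n j) (\<lambda>l. W j $$ (i, l) \<cdot>\<^sub>v (xh l j - xh i j)) (in_nbrs Ec i)) $ r
    - (A j j *\<^sub>v x j + vsum (n j) (\<lambda>l. A j l *\<^sub>v x l) (NA j) + B j *\<^sub>v u j) $ r
    = err_rhs \<mu> (err x xh xb) i j r"
proof -
  note c = coupling_index[OF i j r]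
  have i0: "i \<noteq> 0" using i by auto
  show ?thesis
    using c(1) r unfolding estimate_rhs_index[OF i j r xh[OF i j] smult_carrier_vec[THEN iffD2, OF c(1)]]
      system_rhs_index[OF j r] err_rhs_def consensus_sum[OF j i] weight_zero(1)[OF j i ij]
    by (simp add: c(2) err_def[of _ _ _ i] i0 right_diff_distrib sum_subtractf)
qed

lemma estimate_error_own:
  assumes i: "i \<in> {1..m}" and r: "r < n i"
  shows "(A i i *\<^sub>v xh i i + B i *\<^sub>v u i + vsum (n i) (\<lambda>l. A i l *\<^sub>v xh i l) (NA i)
        + \<mu> \<cdot>\<^sub>v (W i $$ (i, 0) \<cdot>\<^sub>v (xb i - xh i i)
            + vsum (n i) (\<lambda>l. W i $$ (i, l) \<cdot>\<^sub>v (xh l i - xh i i)) (in_nbrs Ec i))) $ r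
    - (A i i *\<^sub>v x i + vsum (n i) (\<lambda>l. A i l *\<^sub>v x l) (NA i) + B i *\<^sub>v u i) $ r
    = err_rhs \<mu> (err x xh xb) i i r"
proof -
  note c = coupling_index[OF i i r]
  have i0: "i \<noteq> 0" using i by auto
  have w: "W i $$ (i, 0) \<cdot>\<^sub>v (xb i - xh i i) \<in> carrier_vec (n i)"
    using xh[OF i i] xb[OF i] by auto
  show ?thesis
    using c(1) w r xh[OF i i] xb[OF i] unfolding estimate_rhs_index[OF i i r xh[OF i i] smult_carrier_vec[THEN iffD2, OF add_carrier_vec[OF w c(1)]]]
      system_rhs_index[OF i r] err_rhs_def consensus_sum[OF i i]
    by (simp add: c(2) err_def[of _ _ _ i] err_def[of _ _ _ 0] i0 right_diff_distrib sum_subtractf)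
qed

lemma auxiliary_error:
  assumes i: "i \<in> {1..m}" and r: "r < n i"
  shows "(A i i *\<^sub>v xb i + B i *\<^sub>v u i + vsum (n i) (\<lambda>l. A i l *\<^sub>v xh i l) (NA i)
      + F i *\<^sub>v ((C i i *\<^sub>v x i + vsum (p i) (\<lambda>j. C i j *\<^sub>v x j) (NC i))
          - (C i i *\<^sub>v xb i + vsum (p i) (\<lambda>l. C i l *\<^sub>v xh i l) (NC i)))) $ r
    - (A i i *\<^sub>v x i + vsum (n i) (\<lambda>l. A i l *\<^sub>v x l) (NA i) + B i *\<^sub>v u i) $ r
    = err_rhs \<mu> (err x xh xb) 0 i r"
proof -
  define y where "y = (C i i *\<^sub>v x i + vsum (p i) (\<lambda>j. C i j *\<^sub>v x j) (NC i))
          - (C i i *\<^sub>v xb i + vsum (p i) (\<lambda>l. C i l *\<^sub>v xh i l) (NC i))"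
  have i0: "i \<noteq> 0" using i by auto
  have v1: "vsum (p i) (\<lambda>j. C i j *\<^sub>v x j) (NC i) $ q = (\<Sum>l\<in>NC i. \<Sum>s<n l. C i l $$ (q, s) * x l $ s)"
    and v2: "vsum (p i) (\<lambda>j. C i j *\<^sub>v xh i j) (NC i) $ q = (\<Sum>l\<in>NC i. \<Sum>s<n l. C i l $$ (q, s) * xh i l $ s)"
    if "q < p i" for q
    using nbrs[of i] C_carrier x xh i that by (intro block_vsum; blast)+
  have vc: "vsum (p i) (\<lambda>j. C i j *\<^sub>v x j) (NC i) \<in> carrier_vec (p i)"
    "vsum (p i) (\<lambda>j. C i j *\<^sub>v xh i j) (NC i) \<in> carrier_vec (p i)"
    using nbrs[of i] C_carrier x xh i by (intro block_vsum; blast)+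
  have y: "y \<in> carrier_vec (p i)" unfolding y_def
    by (intro minus_carrier_vec add_carrier_vec vc mult_mat_vec_carrier[OF C_carrier[OF i i]] x xb i)
  \<comment> \<open>With the true output substituted, the correction term of the auxiliary variable
    measures errors only; the sign flips because errors are estimate minus state.\<close>
  have yq: "y $ q = - ((\<Sum>s<n i. C i i $$ (q, s) * err x xh xb 0 i s)
          + (\<Sum>l\<in>NC i. \<Sum>s<n l. C i l $$ (q, s) * err x xh xb i l s))" if q: "q < p i" for q
    using mult_mat_vec_index_sum[OF C_carrier[OF i i] x[OF i] q]
      mult_mat_vec_index_sum[OF C_carrier[OF i i] xb[OF i] q] v1[OF q] v2[OF q] vc q C_carrier[OF i i]
    unfolding y_def by (simp add: err_def i0 algebra_simps sum_subtractf)
  have Fy: "F i *\<^sub>v y \<in> carrier_vec (n i)" using y F_carrier[OF i] by auto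
  have "(F i *\<^sub>v y) $ r = - (\<Sum>q<p i. F i $$ (r, q) * ((\<Sum>s<n i. C i i $$ (q, s) * err x xh xb 0 i s)
          + (\<Sum>l\<in>NC i. \<Sum>s<n l. C i l $$ (q, s) * err x xh xb i l s)))"
    unfolding mult_mat_vec_index_sum[OF F_carrier[OF i] y r] sum_negf[symmetric]
    by (intro sum.cong refl) (simp only: yq lessThan_iff mult_minus_right)
  then show ?thesis
    unfolding y_def[symmetric] estimate_rhs_index[OF i i r xb[OF i] Fy] system_rhs_index[OF i r] err_rhs_def
    by (simp add: err_def[of _ _ _ 0] err_def[of _ _ _ i] i0 right_diff_distrib sum_subtractf)
qed

end

text \<open>Input and state cancel, which leaves a homogeneous integral equation for the errors
  alone. Read forwards, it reduces stability to the decay of errors; read backwards, it turns a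
  constructed error into a run of the observer.\<close>

lemma observer_trajectory_iff:
  assumes sys: "system_trajectory m n A B u x"
    and u: "\<And>j t. j \<in> {1..m} \<Longrightarrow> t \<ge> 0 \<Longrightarrow> u j t \<in> carrier_vec (k j)"
    and xb: "\<And>j t. j \<in> {1..m} \<Longrightarrow> t \<ge> 0 \<Longrightarrow> xb j t \<in> carrier_vec (n j)"
    and xh: "\<And>i j t. i \<in> {1..m} \<Longrightarrow> j \<in> {1..m} \<Longrightarrow> t \<ge> 0 \<Longrightarrow> xh i j t \<in> carrier_vec (n j)"
    and e: "\<And>t. e t = err (\<lambda>j. x j t) (\<lambda>i j. xh i j t) (\<lambda>j. xb j t)"
  shows "observer_trajectory m n p A B C F Ec W \<mu> u (system_output m p C x) xh xb \<longleftrightarrow>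
    (\<forall>i\<le>m. \<forall>j\<in>{1..m}. \<forall>r<n j. \<forall>t\<ge>0.
      ((\<lambda>s. err_rhs \<mu> (e s) i j r) has_integral (e t i j r - e 0 i j r)) {0..t})"
proof -
  have S: "solves (n j) (x j) (\<lambda>t. A j j *\<^sub>v x j t + vsum (n j) (\<lambda>l. A j l *\<^sub>v x l t) (NA j) + B j *\<^sub>v u j t)"
    if "j \<in> {1..m}" for j
    using sys that by (auto simp: system_trajectory_def)
  then have x: "x j t \<in> carrier_vec (n j)" if "j \<in> {1..m}" "t \<ge> 0" for j t
    using that by (auto simp: solves_def)
  define I where "I i j \<longleftrightarrow> (\<forall>r<n j. \<forall>t\<ge>0.
      ((\<lambda>s. err_rhs \<mu> (e s) i j r) has_integral (e t i j r - e 0 i j r)) {0..t})" for i j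
  define S1 where "S1 i j \<longleftrightarrow> solves (n j) (xh i j) (\<lambda>t.
          A j j *\<^sub>v xh i j t + B j *\<^sub>v u j t + vsum (n j) (\<lambda>l. A j l *\<^sub>v xh i l t) (NA j)
          + \<mu> \<cdot>\<^sub>v vsum (n j) (\<lambda>l. W j $$ (i, l) \<cdot>\<^sub>v (xh l j t - xh i j t)) (in_nbrs Ec i))" for i j
  define S2 where "S2 i \<longleftrightarrow> solves (n i) (xh i i) (\<lambda>t.
          A i i *\<^sub>v xh i i t + B i *\<^sub>v u i t + vsum (n i) (\<lambda>l. A i l *\<^sub>v xh i l t) (NA i)
          + \<mu> \<cdot>\<^sub>v (W i $$ (i, 0) \<cdot>\<^sub>v (xb i t - xh i i t)
               + vsum (n i) (\<lambda>l. W i $$ (i, l) \<cdot>\<^sub>v (xh l i t - xh i i t)) (in_nbrs Ec i)))" for i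
  define S3 where "S3 i \<longleftrightarrow> solves (n i) (xb i) (\<lambda>t.
          A i i *\<^sub>v xb i t + B i *\<^sub>v u i t + vsum (n i) (\<lambda>l. A i l *\<^sub>v xh i l t) (NA i)
          + F i *\<^sub>v (system_output m p C x i t - (C i i *\<^sub>v xb i t
               + vsum (p i) (\<lambda>l. C i l *\<^sub>v xh i l t) (NC i))))" for i
  have other: "S1 i j \<longleftrightarrow> I i j"
    if i: "i \<in> {1..m}" and j: "j \<in> {1..m} - {i}" for i j
  proof -
    have *: "xh i j t $ r - x j t $ r = e t i j r" for t r using i by (simp add: e err_def)
    show ?thesis
      unfolding I_def S1_def *[symmetric]
    proof (rule solves_iff_diff[OF S])
      fix s r assume s: "(0::real) \<le> s" and r: "r < n j"
      show "(A j j *\<^sub>v xh i j s + B j *\<^sub>v u j s + vsum (n j) (\<lambda>l. A j l *\<^sub>v xh i l s) (NA j)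
          + \<mu> \<cdot>\<^sub>v vsum (n j) (\<lambda>l. W j $$ (i, l) \<cdot>\<^sub>v (xh l j s - xh i j s)) (in_nbrs Ec i)) $ r
        - (A j j *\<^sub>v x j s + vsum (n j) (\<lambda>l. A j l *\<^sub>v x l s) (NA j) + B j *\<^sub>v u j s) $ r
        = err_rhs \<mu> (e s) i j r"
        unfolding e
        by (rule estimate_error_other[where x = "\<lambda>j. x j s" and u = "\<lambda>j. u j s" and xb = "\<lambda>j. xb j s" and xh = "\<lambda>i j. xh i j s"])
          (use i j r s x u xb xh in simp_all)
    qed (use i j xh in auto)
  qed
  have own: "S2 i \<longleftrightarrow> I i i"
    if i: "i \<in> {1..m}" for i
  proof -
    have *: "xh i i t $ r - x i t $ r = e t i i r" for t r using i by (simp add: e err_def)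
    show ?thesis
      unfolding I_def S2_def *[symmetric]
    proof (rule solves_iff_diff[OF S])
      fix s r assume s: "(0::real) \<le> s" and r: "r < n i"
      show "(A i i *\<^sub>v xh i i s + B i *\<^sub>v u i s + vsum (n i) (\<lambda>l. A i l *\<^sub>v xh i l s) (NA i)
          + \<mu> \<cdot>\<^sub>v (W i $$ (i, 0) \<cdot>\<^sub>v (xb i s - xh i i s)
               + vsum (n i) (\<lambda>l. W i $$ (i, l) \<cdot>\<^sub>v (xh l i s - xh i i s)) (in_nbrs Ec i))) $ r
        - (A i i *\<^sub>v x i s + vsum (n i) (\<lambda>l. A i l *\<^sub>v x l s) (NA i) + B i *\<^sub>v u i s) $ r
        = err_rhs \<mu> (e s) i i r"
        unfolding e
        by (rule estimate_error_own[where x = "\<lambda>j. x j s" and u = "\<lambda>j. u j s" and xb = "\<lambda>j. xb j s" and xh = "\<lambda>i j. xh i j s"])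
          (use i r s x u xb xh in simp_all)
    qed (use i xh in auto)
  qed
  have aux: "S3 i \<longleftrightarrow> I 0 i"
    if i: "i \<in> {1..m}" for i
  proof -
    have *: "xb i t $ r - x i t $ r = e t 0 i r" for t r by (simp add: e err_def)
    show ?thesis
      unfolding I_def S3_def *[symmetric] system_output_def
    proof (rule solves_iff_diff[OF S])
      fix s r assume s: "(0::real) \<le> s" and r: "r < n i"
      show "(A i i *\<^sub>v xb i s + B i *\<^sub>v u i s + vsum (n i) (\<lambda>l. A i l *\<^sub>v xh i l s) (NA i)
          + F i *\<^sub>v ((C i i *\<^sub>v x i s + vsum (p i) (\<lambda>j. C i j *\<^sub>v x j s) (NC i)) - (C i i *\<^sub>v xb i s
               + vsum (p i) (\<lambda>l. C i l *\<^sub>v xh i l s) (NC i)))) $ r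
        - (A i i *\<^sub>v x i s + vsum (n i) (\<lambda>l. A i l *\<^sub>v x l s) (NA i) + B i *\<^sub>v u i s) $ r
        = err_rhs \<mu> (e s) 0 i r"
        unfolding e
        by (rule auxiliary_error[where x = "\<lambda>j. x j s" and u = "\<lambda>j. u j s" and xb = "\<lambda>j. xb j s" and xh = "\<lambda>i j. xh i j s"])
          (use i r s x u xb xh in simp_all)
    qed (use i xb in auto)
  qed
  have "observer_trajectory m n p A B C F Ec W \<mu> u (system_output m p C x) xh xb \<longleftrightarrow>
    (\<forall>i\<in>{1..m}. (\<forall>j\<in>{1..m} - {i}. S1 i j) \<and> S2 i \<and> S3 i)"
    unfolding observer_trajectory_def S1_def S2_def S3_def ..
  also have "\<dots> \<longleftrightarrow> (\<forall>i\<in>{1..m}. (\<forall>j\<in>{1..m} - {i}. I i j) \<and> I i i \<and> I 0 i)"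
    using other own aux by blast
  also have "\<dots> \<longleftrightarrow> (\<forall>i\<le>m. \<forall>j\<in>{1..m}. I i j)"
  proof
    assume *: "\<forall>i\<in>{1..m}. (\<forall>j\<in>{1..m} - {i}. I i j) \<and> I i i \<and> I 0 i"
    show "\<forall>i\<le>m. \<forall>j\<in>{1..m}. I i j"
    proof (intro allI impI ballI)
      fix i j assume "i \<le> m" "j \<in> {1..m}"
      then show "I i j" using * by (cases "i = 0"; cases "i = j") auto
    qed
  qed auto
  finally show ?thesis unfolding I_def .
qed

end

section \<open>Error trajectories and their decay\<close>

context observer_network
begin

definition error_trajectory :: "real \<Rightarrow> (real \<Rightarrow> nat \<Rightarrow> nat \<Rightarrow> nat \<Rightarrow> real) \<Rightarrow> bool" where
  "error_trajectory \<mu> e \<longleftrightarrow> (\<forall>i\<le>m. \<forall>j\<in>{1..m}. \<forall>r<n j. \<forall>t\<ge>0.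
     ((\<lambda>s. err_rhs \<mu> (e s) i j r) has_integral (e t i j r - e 0 i j r)) {0..t})"

lemma continuous_on_err_rhs:
  assumes e: "\<And>i j r. i \<le> m \<Longrightarrow> j \<in> {1..m} \<Longrightarrow> r < n j \<Longrightarrow> continuous_on T (\<lambda>t. e t i j r)"
    and i: "i \<le> m" and j: "j \<in> {1..m}" and r: "r < n j"
  shows "continuous_on T (\<lambda>t. err_rhs \<mu> (e t) i j r)"
proof -
  have l: "l \<in> {1..m}" if "l \<in> NA j \<or> l \<in> NC j" for l using nbrs[of j] that by auto
  show ?thesis
    unfolding err_rhs_def using i j r l
    by (cases "i = 0") (auto intro!: continuous_intros e)
qed

text \<open>A bootstrap: errors are indefinite integrals and hence continuous, so their right-hand
  sides, linear in the errors, are continuous too, and the fundamental theorem of calculus applies.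
  The two-sided derivative requires \<open>t > 0\<close>.\<close>

lemma error_trajectory_deriv:
  assumes e: "error_trajectory \<mu> e" and i: "i \<le> m" and j: "j \<in> {1..m}" and r: "r < n j" and t: "t > 0"
  shows "((\<lambda>t. e t i j r) has_vector_derivative err_rhs \<mu> (e t) i j r) (at t)"
proof (rule has_vector_derivative_primitive[OF _ _ t])
  have "continuous_on {0..} (\<lambda>t. e t i j r)" if "i \<le> m" "j \<in> {1..m}" "r < n j" for i j r
    using e that unfolding error_trajectory_def by (intro continuous_on_primitive) blast
  then show "continuous_on {0..} (\<lambda>t. err_rhs \<mu> (e t) i j r)"
    by (intro continuous_on_err_rhs i j r)
qed (use e i j r in \<open>auto simp: error_trajectory_def\<close>)

text \<open>Collects the terms in the auxiliary error itself into the matrix assumed to be Hurwitz;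
  what remains concerns in-neighbours of j in the dynamics and sensing graphs, and is later treated
  as forcing.\<close>

lemma auxiliary_err_rhs:
  assumes j: "j \<in> {1..m}" and r: "r < n j"
  shows "err_rhs \<mu> e 0 j r = (\<Sum>s<n j. (A j j - F j * C j j) $$ (r, s) * e 0 j s)
     + ((\<Sum>l\<in>NA j. \<Sum>s<n l. A j l $$ (r, s) * e j l s)
       - (\<Sum>q<p j. F j $$ (r, q) * (\<Sum>l\<in>NC j. \<Sum>s<n l. C j l $$ (q, s) * e j l s)))"
proof -
  have "(\<Sum>s<n j. (A j j - F j * C j j) $$ (r, s) * e 0 j s)
    = (\<Sum>s<n j. A j j $$ (r, s) * e 0 j s - (\<Sum>q<p j. F j $$ (r, q) * C j j $$ (q, s)) * e 0 j s)"
    using mult_entry_sum[OF F_carrier[OF j] C_carrier[OF j j] r] F_carrier[OF j] C_carrier[OF j j] r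
    by (intro sum.cong refl) (simp add: left_diff_distrib del: index_mult_mat(1))
  also have "\<dots> = (\<Sum>s<n j. A j j $$ (r, s) * e 0 j s)
      - (\<Sum>q<p j. F j $$ (r, q) * (\<Sum>s<n j. C j j $$ (q, s) * e 0 j s))"
    unfolding sum_subtractf sum_distrib_left sum_distrib_right
    by (subst (2) sum.swap) (simp add: mult.assoc)
  finally show ?thesis
    by (simp add: err_rhs_def distrib_left sum.distrib)
qed

text \<open>The auxiliary error plays the part of the reference node. Its weight stays on the
  diagonal of the grounded Laplacian, while its value goes into the forcing. The passage to complex
  numbers matches the spectral decay lemma.\<close>

lemma estimate_err_rhs:
  assumes i: "i < m" and j: "j \<in> {1..m}" and r: "r < n j"
  shows "complex_of_real (err_rhs \<mu> e (Suc i) j r)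
    = (\<Sum>s<n j. map_mat complex_of_real (A j j) $$ (r, s) * e (Suc i) j s)
      - \<mu> * (\<Sum>l<m. grounded_laplacian m (W j) $$ (i, l) * e (Suc l) j r)
      + of_real ((\<Sum>l\<in>NA j. \<Sum>s<n l. A j l $$ (r, s) * e (Suc i) l s) + \<mu> * W j $$ (Suc i, 0) * e 0 j r)"
proof -
  define D where "D = (\<Sum>s<n j. A j j $$ (r, s) * e (Suc i) j s)"
  define G where "G = W j $$ (Suc i, 0) * e (Suc i) j r
          + (\<Sum>l\<in>{1..m}. W j $$ (Suc i, l) * (e (Suc i) j r - e l j r))"
  have "(\<Sum>s<n j. map_mat complex_of_real (A j j) $$ (r, s) * e (Suc i) j s) = of_real D"
    unfolding D_def using A_carrier[OF j j] r by simp
  moreover have "(\<Sum>l<m. grounded_laplacian m (W j) $$ (i, l) * e (Suc l) j r) = of_real G"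
    unfolding G_def using grounded_laplacian_sum[OF i, of "W j" "\<lambda>l. complex_of_real (e l j r)"] by simp
  moreover have G: "(\<Sum>l\<le>m. W j $$ (Suc i, l) * (e l j r - e (Suc i) j r)) = W j $$ (Suc i, 0) * e 0 j r - G"
    by (simp add: G_def sum.atMost_shift sum.atLeast1_atMost_eq right_diff_distrib sum_subtractf)
  have "err_rhs \<mu> e (Suc i) j r = D - \<mu> * G
      + ((\<Sum>l\<in>NA j. \<Sum>s<n l. A j l $$ (r, s) * e (Suc i) l s) + \<mu> * W j $$ (Suc i, 0) * e 0 j r)"
    unfolding err_rhs_def G by (simp add: D_def right_diff_distrib)
  ultimately show ?thesis by (simp only: of_real_add of_real_diff of_real_mult)
qed

lemma error_decay:
  fixes rank :: "nat \<Rightarrow> nat"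
  assumes rank: "\<And>j l. l \<in> NA j \<union> NC j \<Longrightarrow> rank l < rank j"
    and hurw: "\<And>j. j \<in> {1..m} \<Longrightarrow> hurwitz (A j j - F j * C j j)"
    and gain: "\<And>j \<alpha> \<beta>. j \<in> {1..m} \<Longrightarrow> eigenvalue (map_mat complex_of_real (A j j)) \<alpha> \<Longrightarrow>
        eigenvalue (grounded_laplacian m (W j)) \<beta> \<Longrightarrow> Re \<alpha> < \<mu> * Re \<beta>"
    and e: "error_trajectory \<mu> e"
    and "i \<le> m" "j \<in> {1..m}" "r < n j"
  shows "((\<lambda>t. e t i j r) \<longlongrightarrow> 0) at_top"
  using \<open>i \<le> m\<close> \<open>j \<in> {1..m}\<close> \<open>r < n j\<close>
\<comment> \<open>The first index is generalised: the estimates of \<open>x j\<close> are forced by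
  each agent's own estimates of the preceding states, and the auxiliary variable by those of agent
  j.\<close>
proof (induction "rank j" arbitrary: i j r rule: less_induct)
  case less
  note j = less.prems(2)
  have IH: "((\<lambda>t. e t i l s) \<longlongrightarrow> 0) at_top" if "l \<in> NA j \<union> NC j" "i \<le> m" "s < n l" for i l s
    using less.hyps[OF rank] nbrs[of j] that by blast
  note deriv = error_trajectory_deriv[OF e, folded has_real_derivative_iff_has_vector_derivative]
  have IHsum: "((\<lambda>t. \<Sum>l\<in>S. \<Sum>s<n l. c l s * e t i l s) \<longlongrightarrow> 0) at_top"
    if "S \<subseteq> NA j \<union> NC j" "i \<le> m" for c S i
  proof -
    have "((\<lambda>t. \<Sum>l\<in>S. \<Sum>s<n l. c l s * e t i l s) \<longlongrightarrow> (\<Sum>l\<in>S. \<Sum>s<n l. c l s * 0)) at_top"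
      using that by (intro tendsto_intros IH) auto
    then show ?thesis by simp
  qed
  have aux: "((\<lambda>t. e t 0 j r) \<longlongrightarrow> 0) at_top" if r: "r < n j" for r
  proof -
    define h where "h r t = (\<Sum>l\<in>NA j. \<Sum>s<n l. A j l $$ (r, s) * e t j l s)
       - (\<Sum>q<p j. F j $$ (r, q) * (\<Sum>l\<in>NC j. \<Sum>s<n l. C j l $$ (q, s) * e t j l s))" for r t
    have h: "(h r \<longlongrightarrow> 0) at_top" for r
    proof -
      have "((\<lambda>t. (\<Sum>l\<in>NA j. \<Sum>s<n l. A j l $$ (r, s) * e t j l s)
       - (\<Sum>q<p j. F j $$ (r, q) * (\<Sum>l\<in>NC j. \<Sum>s<n l. C j l $$ (q, s) * e t j l s)))
          \<longlongrightarrow> 0 - (\<Sum>q<p j. F j $$ (r, q) * 0)) at_top"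
        using j by (intro tendsto_intros IHsum) auto
      then show ?thesis by (simp add: h_def[abs_def])
    qed
    let ?D = "map_mat complex_of_real (A j j - F j * C j j)"
    have c: "A j j - F j * C j j \<in> carrier_mat (n j) (n j)"
      using A_carrier[OF j j] F_carrier[OF j] C_carrier[OF j j] by auto
    have "((\<lambda>t. complex_of_real (e t 0 j r)) \<longlongrightarrow> 0) at_top"
    \<comment> \<open>A single column without coupling: for \<mu> = 0 the condition on real parts
      just says that all eigenvalues of D lie in the open left half-plane.\<close>
    proof (rule sylvester_ode_decay[where D = ?D and N = "n j" and L = "0\<^sub>m 1 1" and M = 1 and \<mu> = 0
          and z = "\<lambda>i r t. complex_of_real (e t 0 j r)" and h = "\<lambda>i r t. complex_of_real (h r t)" and i = 0])
      show "Re \<alpha> < 0 * Re \<beta>" if "eigenvalue ?D \<alpha>" for \<alpha> \<beta>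
        using hurw[OF j] that by (simp add: hurwitz_def)
      fix i r and t :: real assume r: "r < n j" and t: "t > 0"
      have "err_rhs \<mu> (e t) 0 j r = (\<Sum>s<n j. (A j j - F j * C j j) $$ (r, s) * e t 0 j s) + h r t"
        unfolding h_def by (rule auxiliary_err_rhs[OF j r])
      moreover have "(\<Sum>s<n j. ?D $$ (r, s) * e t 0 j s)
          = of_real (\<Sum>s<n j. (A j j - F j * C j j) $$ (r, s) * e t 0 j s)"
        unfolding of_real_sum of_real_mult using c r by (intro sum.cong refl) (simp del: index_minus_mat)
      ultimately have eq: "complex_of_real (err_rhs \<mu> (e t) 0 j r) = (\<Sum>s<n j. ?D $$ (r, s) * e t 0 j s)
          - complex_of_real 0 * (\<Sum>l<1. 0\<^sub>m 1 1 $$ (i, l) * complex_of_real (e t 0 j r)) + h r t"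
        by simp
      show "((\<lambda>t. complex_of_real (e t 0 j r)) has_vector_derivative
         (\<Sum>s<n j. ?D $$ (r, s) * e t 0 j s)
          - complex_of_real 0 * (\<Sum>l<1. 0\<^sub>m 1 1 $$ (i, l) * complex_of_real (e t 0 j r)) + h r t) (at t)"
        unfolding eq[symmetric] by (intro has_vector_derivative_of_real deriv j r t) simp
    qed (use c h r tendsto_of_real[OF h] in auto)
    then show ?thesis by (simp add: tendsto_of_real_iff[of _ 0, simplified])
  qed
  show ?case
  proof (cases i)
    case 0
    then show ?thesis using aux less.prems by simp
  next
    case (Suc i')
    define h where "h i r t = (\<Sum>l\<in>NA j. \<Sum>s<n l. A j l $$ (r, s) * e t (Suc i) l s)
        + \<mu> * W j $$ (Suc i, 0) * e t 0 j r" for i r t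
    have h: "(h i r \<longlongrightarrow> 0) at_top" if "i < m" "r < n j" for i r
    proof -
      have "((\<lambda>t. (\<Sum>l\<in>NA j. \<Sum>s<n l. A j l $$ (r, s) * e t (Suc i) l s)
        + \<mu> * W j $$ (Suc i, 0) * e t 0 j r) \<longlongrightarrow> 0 + \<mu> * W j $$ (Suc i, 0) * 0) at_top"
        using that by (intro tendsto_intros IHsum aux) auto
      then show ?thesis by (simp add: h_def[abs_def])
    qed
    let ?D = "map_mat complex_of_real (A j j)"
    have "((\<lambda>t. complex_of_real (e t (Suc i') j r)) \<longlongrightarrow> 0) at_top"
    proof (rule sylvester_ode_decay[where D = ?D and N = "n j" and L = "grounded_laplacian m (W j)"
          and M = m and \<mu> = \<mu>
          and z = "\<lambda>i r t. complex_of_real (e t (Suc i) j r)" and h = "\<lambda>i r t. complex_of_real (h i r t)"])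
      fix i r and t :: real assume i: "i < m" and r: "r < n j" and t: "t > 0"
      show "((\<lambda>t. complex_of_real (e t (Suc i) j r)) has_vector_derivative
         (\<Sum>s<n j. ?D $$ (r, s) * e t (Suc i) j s)
          - \<mu> * (\<Sum>l<m. grounded_laplacian m (W j) $$ (i, l) * e t (Suc l) j r) + h i r t) (at t)"
        unfolding h_def estimate_err_rhs[OF i j r, symmetric]
        using i by (intro has_vector_derivative_of_real deriv j r t) simp
    qed (use A_carrier[OF j j] grounded_laplacian_carrier gain[OF j] tendsto_of_real[OF h] less.prems Suc in auto)
    then show ?thesis unfolding Suc by (simp add: tendsto_of_real_iff[of _ 0, simplified])
  qed
qed

section \<open>Linear forms in the error coordinates and existence of trajectories\<close>

definition idx :: "(nat \<times> nat \<times> nat) set" where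
  "idx = {..m} \<times> (SIGMA j:{1..m}. {..<n j})"

lemma idx_iff [simp]: "(i, j, r) \<in> idx \<longleftrightarrow> i \<le> m \<and> j \<in> {1..m} \<and> r < n j"
  by (auto simp: idx_def)

lemma finite_idx: "finite idx"
  by (simp add: idx_def)

text \<open>Linearity means the existence of a coefficient row. Closure rules then show that
  right-hand sides are linear, and their coefficient matrix never has to be written out.\<close>

definition lin_form :: "((nat \<Rightarrow> nat \<Rightarrow> nat \<Rightarrow> real) \<Rightarrow> real) \<Rightarrow> bool" where
  "lin_form \<phi> \<longleftrightarrow> (\<exists>M. \<forall>e. \<phi> e = (\<Sum>b\<in>idx. M b * e (fst b) (fst (snd b)) (snd (snd b))))"

lemma lin_form_coord:
  assumes "i \<le> m" "j \<in> {1..m}" "r < n j"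
  shows "lin_form (\<lambda>e. e i j r)"
  unfolding lin_form_def
proof (intro exI[of _ "\<lambda>b. if b = (i, j, r) then 1 else 0"] allI)
  fix e :: "nat \<Rightarrow> nat \<Rightarrow> nat \<Rightarrow> real"
  have "(\<Sum>b\<in>idx. (if b = (i, j, r) then 1 else 0) * e (fst b) (fst (snd b)) (snd (snd b)))
    = (\<Sum>b\<in>idx. if b = (i, j, r) then e i j r else 0)"
    by (intro sum.cong) auto
  also have "\<dots> = e i j r" using assms finite_idx by (simp del: idx_iff add: idx_def)
  finally show "e i j r = (\<Sum>b\<in>idx. (if b = (i, j, r) then 1 else 0) * e (fst b) (fst (snd b)) (snd (snd b)))" ..
qed

lemma lin_form_cmult: "lin_form \<phi> \<Longrightarrow> lin_form (\<lambda>e. c * \<phi> e)"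
  unfolding lin_form_def
proof (elim exE)
  fix M assume "\<forall>e. \<phi> e = (\<Sum>b\<in>idx. M b * e (fst b) (fst (snd b)) (snd (snd b)))"
  then show "\<exists>M. \<forall>e. c * \<phi> e = (\<Sum>b\<in>idx. M b * e (fst b) (fst (snd b)) (snd (snd b)))"
    by (intro exI[of _ "\<lambda>b. c * M b"]) (simp add: sum_distrib_left mult.assoc)
qed

lemma lin_form_add: "lin_form \<phi> \<Longrightarrow> lin_form \<psi> \<Longrightarrow> lin_form (\<lambda>e. \<phi> e + \<psi> e)"
  unfolding lin_form_def
proof (elim exE)
  fix M N
  assume "\<forall>e. \<phi> e = (\<Sum>b\<in>idx. M b * e (fst b) (fst (snd b)) (snd (snd b)))"
    "\<forall>e. \<psi> e = (\<Sum>b\<in>idx. N b * e (fst b) (fst (snd b)) (snd (snd b)))"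
  then show "\<exists>M. \<forall>e. \<phi> e + \<psi> e = (\<Sum>b\<in>idx. M b * e (fst b) (fst (snd b)) (snd (snd b)))"
    by (intro exI[of _ "\<lambda>b. M b + N b"]) (simp add: distrib_right sum.distrib)
qed

lemma lin_form_diff: "lin_form \<phi> \<Longrightarrow> lin_form \<psi> \<Longrightarrow> lin_form (\<lambda>e. \<phi> e - \<psi> e)"
  using lin_form_add[of \<phi> "\<lambda>e. - 1 * \<psi> e"] lin_form_cmult[of \<psi> "- 1"] by simp

lemma lin_form_sum: "(\<And>a. a \<in> S \<Longrightarrow> lin_form (\<phi> a)) \<Longrightarrow> lin_form (\<lambda>e. \<Sum>a\<in>S. \<phi> a e)"
proof (induction S rule: infinite_finite_induct)
  case (insert a S)
  then show ?case by (simp add: lin_form_add)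
qed (auto simp: lin_form_def intro!: exI[of _ "\<lambda>_. 0"])

lemmas lin_form_intros = lin_form_coord lin_form_cmult lin_form_add lin_form_diff lin_form_sum

lemma lin_form_err_rhs:
  assumes "i \<le> m" "j \<in> {1..m}" "r < n j"
  shows "lin_form (\<lambda>e. err_rhs \<mu> e i j r)"
proof -
  have l: "l \<in> {1..m}" if "l \<in> NA j \<or> l \<in> NC j" for l using nbrs[of j] that by auto
  show ?thesis
  proof (cases "i = 0")
    case True
    show ?thesis
      unfolding err_rhs_def if_P[OF True] using assms l by (intro lin_form_intros) auto
  next
    case False
    show ?thesis
      unfolding err_rhs_def if_not_P[OF False] using assms l by (intro lin_form_intros) auto
  qed
qed

text \<open>A linear form in the coordinates of \<open>idx\<close> cannot see values outside it.
  This matters because errors rebuilt from vectors agree with the given ones only within the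
  dimensions.\<close>

lemma err_rhs_cong:
  assumes "i \<le> m" "j \<in> {1..m}" "r < n j"
    and e: "\<And>i j r. i \<le> m \<Longrightarrow> j \<in> {1..m} \<Longrightarrow> r < n j \<Longrightarrow> e i j r = e' i j r"
  shows "err_rhs \<mu> e i j r = err_rhs \<mu> e' i j r"
proof -
  obtain M where M: "\<And>e. err_rhs \<mu> e i j r = (\<Sum>b\<in>idx. M b * e (fst b) (fst (snd b)) (snd (snd b)))"
    using lin_form_err_rhs[OF assms(1-3), of \<mu>] unfolding lin_form_def by blast
  show ?thesis unfolding M by (intro sum.cong) (auto simp: idx_def e)
qed

text \<open>The coordinates in P are known functions. Their integrals are moved into the
  inhomogeneity, and the rest is a linear integral equation in the remaining coordinates. The
  equations belonging to P are left to the caller to verify.\<close>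

lemma linear_system_solvable:
  fixes q f :: "nat \<times> nat \<times> nat \<Rightarrow> real \<Rightarrow> real"
  assumes lin: "\<And>a. a \<in> idx - P \<Longrightarrow> lin_form (\<phi> a)" and P: "P \<subseteq> idx"
    and q: "\<And>a. a \<in> P \<Longrightarrow> continuous_on {0..} (q a)"
    and f: "\<And>a. a \<in> idx - P \<Longrightarrow> continuous_on {0..} (f a)"
  obtains e where "\<And>i j r t. (i, j, r) \<in> P \<Longrightarrow> e t i j r = q (i, j, r) t"
    "\<And>i j r t. (i, j, r) \<in> idx - P \<Longrightarrow> t \<ge> 0 \<Longrightarrow>
      ((\<lambda>s. \<phi> (i, j, r) (e s)) has_integral (e t i j r - f (i, j, r) t)) {0..t}"
proof -
  from lin have "\<forall>a\<in>idx - P. \<exists>M. \<forall>e. \<phi> a e = (\<Sum>b\<in>idx. M b * e (fst b) (fst (snd b)) (snd (snd b)))"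
    by (simp add: lin_form_def)
  from bchoice[OF this] obtain M where M: "\<And>a e. a \<in> idx - P \<Longrightarrow>
      \<phi> a e = (\<Sum>b\<in>idx. M a b * e (fst b) (fst (snd b)) (snd (snd b)))"
    by blast
  have integ: "g integrable_on {0..T}" if "continuous_on {0..} g" for g :: "real \<Rightarrow> real" and T
    using that by (intro integrable_continuous_real) (auto elim: continuous_on_subset)
  define g where "g a t = f a t + (\<Sum>b\<in>P. M a b * integral {0..t} (q b))" for a t
  have g: "continuous_on {0..} (g a)" if "a \<in> idx - P" for a
  proof -
    have "continuous_on {0..} (\<lambda>t. integral {0..t} (q b))" if "b \<in> P" for b
      by (intro continuous_on_indefinite_integral integ q that)
    then show ?thesis
      unfolding g_def using that by (intro continuous_on_add f continuous_on_sum continuous_on_mult_left)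
  qed
  obtain z where zc: "\<And>a. a \<in> idx - P \<Longrightarrow> continuous_on {0..} (z a)"
    and z: "\<And>a t. a \<in> idx - P \<Longrightarrow> t \<ge> 0 \<Longrightarrow> z a t = g a t + (\<Sum>b\<in>idx - P. M a b * integral {0..t} (z b))"
    by (rule volterra_solvable[OF finite_Diff[OF finite_idx] g, where M = M], assumption, rule that)
  define e where "e t i j r = (if (i, j, r) \<in> P then q (i, j, r) t else z (i, j, r) t)" for t i j r
  have int: "((\<lambda>s. \<phi> a (e s)) has_integral (z a t - f a t)) {0..t}" if a: "a \<in> idx - P" and t: "t \<ge> 0" for a t
  proof -
    define y where "y b = (if b \<in> P then q b else z b)" for b
    have "y b integrable_on {0..t}" if "b \<in> idx" for b
      using that q[of b] zc[of b] by (cases "b \<in> P") (simp_all add: y_def integ)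
    then have "((\<lambda>s. \<Sum>b\<in>idx. M a b * y b s) has_integral (\<Sum>b\<in>idx. M a b * integral {0..t} (y b))) {0..t}"
      by (intro has_integral_sum finite_idx has_integral_mult_right integrable_integral)
    moreover have "(\<lambda>s. \<phi> a (e s)) = (\<lambda>s. \<Sum>b\<in>idx. M a b * y b s)"
      unfolding M[OF a] by (intro ext sum.cong) (auto simp: e_def y_def)
    moreover have "(\<Sum>b\<in>idx. M a b * integral {0..t} (y b)) = z a t - f a t"
    proof -
      have "(\<Sum>b\<in>idx. M a b * integral {0..t} (y b))
        = (\<Sum>b\<in>idx - P. M a b * integral {0..t} (y b)) + (\<Sum>b\<in>P. M a b * integral {0..t} (y b))"
        by (rule sum.subset_diff[OF P finite_idx])
      also have "\<dots> = (\<Sum>b\<in>idx - P. M a b * integral {0..t} (z b)) + (\<Sum>b\<in>P. M a b * integral {0..t} (q b))"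
        by (simp add: y_def)
      finally show ?thesis using z[OF a t] by (simp add: g_def)
    qed
    ultimately show ?thesis by simp
  qed
  show thesis
  proof (rule that[of e])
    show "e t i j r = q (i, j, r) t" if "(i, j, r) \<in> P" for i j r t
      using that by (simp add: e_def)
    show "((\<lambda>s. \<phi> (i, j, r) (e s)) has_integral (e t i j r - f (i, j, r) t)) {0..t}"
      if "(i, j, r) \<in> idx - P" "t \<ge> 0" for i j r t
      using int[OF that] that(1) by (simp add: e_def)
  qed
qed

text \<open>Rules out vacuous stability: some state trajectory exists for every bounded input. The
  integral of the input is continuous even though the input need not be, so it can serve as
  inhomogeneity.\<close>

lemma system_trajectory_exists:
  assumes u: "\<And>j. j \<in> {1..m} \<Longrightarrow> bounded_signal (k j) (u j)"
  obtains x where "system_trajectory m n A B u x"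
proof -
  define g where "g j r t = (B j *\<^sub>v u j t) $ r" for j r t
  have uc: "u j t \<in> carrier_vec (k j)" if "j \<in> {1..m}" "t \<ge> 0" for j t
    using u that by (auto simp: bounded_signal_def)
  have g: "g j r integrable_on {0..T}" if "j \<in> {1..m}" "r < n j" for j r T
  proof -
    have "(\<lambda>t. \<Sum>s<k j. B j $$ (r, s) * u j t $ s) integrable_on {0..T}"
      using u that by (intro integrable_sum integrable_on_mult_right bounded_signal_integrable) auto
    then show ?thesis
    proof (rule integrable_eq)
      fix t assume "t \<in> {0..T}"
      then show "(\<Sum>s<k j. B j $$ (r, s) * u j t $ s) = g j r t"
        using mult_mat_vec_index_sum[OF B_carrier[OF that(1)] uc[OF that(1)] that(2)] by (simp add: g_def)
    qed
  qed
  \<comment> \<open>The solver works with triples, so the system is solved in m + 1 identical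
    uncoupled copies, of which copy 0 is read off.\<close>
  define \<phi> :: "nat \<times> nat \<times> nat \<Rightarrow> (nat \<Rightarrow> nat \<Rightarrow> nat \<Rightarrow> real) \<Rightarrow> real" where
    "\<phi> = (\<lambda>(i, j, r) e. (\<Sum>s<n j. A j j $$ (r, s) * e i j s) + (\<Sum>l\<in>NA j. \<Sum>s<n l. A j l $$ (r, s) * e i l s))"
  define f where "f = (\<lambda>(i :: nat, j, r) t. integral {0..t} (g j r))"
  obtain e where e: "\<And>i j r t. (i, j, r) \<in> idx - {} \<Longrightarrow> t \<ge> 0 \<Longrightarrow>
      ((\<lambda>s. \<phi> (i, j, r) (e s)) has_integral (e t i j r - f (i, j, r) t)) {0..t}"
  proof (rule linear_system_solvable[of "{}" \<phi> "\<lambda>_ _. 0" f])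
    fix a assume "a \<in> idx - {}"
    then obtain i j r where a: "a = (i, j, r)" "i \<le> m" "j \<in> {1..m}" "r < n j" by (cases a) auto
    have l: "l \<in> {1..m}" if "l \<in> NA j" for l using nbrs[of j] that by auto
    show "lin_form (\<phi> a)"
      unfolding \<phi>_def a(1) prod.case using a l by (intro lin_form_intros) auto
    show "continuous_on {0..} (f a)"
      unfolding f_def a(1) prod.case by (intro continuous_on_indefinite_integral g a)
  qed auto
  define x where "x j t = vec (n j) (\<lambda>r. e t 0 j r)" for j t
  have "system_trajectory m n A B u x"
    unfolding system_trajectory_def solves_def
  proof (intro ballI allI impI conjI)
    fix j r and t :: real assume j: "j \<in> {1..m}" and t: "t \<ge> 0" and r: "r < n j"
    \<comment> \<open>Here the first 0 is the time and the second the copy. The constructed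
      trajectory starts at the origin, because the integral over a point vanishes.\<close>
    have "e 0 0 j r - f (0, j, r) 0 = 0"
      by (rule has_integral_unique[OF e]) (use j r in \<open>simp_all add: has_integral_refl\<close>)
    then have e0: "e 0 0 j r = 0" by (simp add: f_def)
    have "((\<lambda>s. \<phi> (0, j, r) (e s) + g j r s) has_integral (e t 0 j r - f (0, j, r) t + integral {0..t} (g j r))) {0..t}"
      using j r t by (intro has_integral_add e integrable_integral g) auto
    then have "((\<lambda>s. \<phi> (0, j, r) (e s) + g j r s) has_integral (x j t $ r - x j 0 $ r)) {0..t}"
      using r e0 by (simp add: x_def f_def)
    then show "((\<lambda>s. (A j j *\<^sub>v x j s + vsum (n j) (\<lambda>l. A j l *\<^sub>v x l s) (NA j) + B j *\<^sub>v u j s) $ r)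
        has_integral (x j t $ r - x j 0 $ r)) {0..t}"
    proof (rule has_integral_eq[rotated])
      fix s assume s: "s \<in> {0..t}"
      have "(A j j *\<^sub>v x j s + vsum (n j) (\<lambda>l. A j l *\<^sub>v x l s) (NA j) + B j *\<^sub>v u j s) $ r
        = (\<Sum>q<n j. A j j $$ (r, q) * x j s $ q) + (\<Sum>l\<in>NA j. \<Sum>q<n l. A j l $$ (r, q) * x l s $ q) + g j r s"
        unfolding g_def
        by (rule system_rhs_index[where x = "\<lambda>j. x j s" and u = "\<lambda>j. u j s"
              and xb = "\<lambda>j. 0\<^sub>v (n j)" and xh = "\<lambda>i j. 0\<^sub>v (n j)"])
          (use j r uc s in \<open>simp_all add: x_def\<close>)
      then show "\<phi> (0, j, r) (e s) + g j r s
        = (A j j *\<^sub>v x j s + vsum (n j) (\<lambda>l. A j l *\<^sub>v x l s) (NA j) + B j *\<^sub>v u j s) $ r"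
        by (simp add: \<phi>_def x_def)
    qed
  qed (simp add: x_def)
  then show thesis by (rule that)
qed

text \<open>Agents that receive no information from outside S and do not include agent a may agree on any
  free motion of agent a: neither the coupling nor the errors of the preceding agents, all zero,
  correct it.\<close>

lemma error_trajectory_with_mode:
  fixes rank :: "nat \<Rightarrow> nat" and \<xi> :: "nat \<Rightarrow> real \<Rightarrow> real"
  assumes rank: "\<And>j l. l \<in> NA j \<union> NC j \<Longrightarrow> rank l < rank j"
    and a: "a \<in> {1..m}" and S: "S \<subseteq> {1..m}" "a \<notin> S"
    and closed: "\<And>i l. i \<in> S \<Longrightarrow> l \<in> in_nbrs Ec i \<Longrightarrow> l \<in> S"
    and \<xi>c: "\<And>r. continuous_on {0..} (\<xi> r)"
    and \<xi>: "\<And>r t. r < n a \<Longrightarrow> t \<ge> 0 \<Longrightarrow>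
      ((\<lambda>s. \<Sum>q<n a. A a a $$ (r, q) * \<xi> q s) has_integral (\<xi> r t - \<xi> r 0)) {0..t}"
  obtains e where "error_trajectory \<mu> e" "\<And>i r t. i \<in> S \<Longrightarrow> r < n a \<Longrightarrow> e t i a r = \<xi> r t"
proof -
  \<comment> \<open>The prescribed coordinates: the motion \<xi> for the estimates of
    \<open>x a\<close> held in S, and zero for every other state of rank at most that of a. No
    remaining coordinate enters their equations, so these can be checked directly. The remaining
    coordinates are determined by the solver.\<close>
  define P where "P = {(i, j, r). (i, j, r) \<in> idx \<and> (if j = a then i \<in> S else rank j \<le> rank a)}"
  define q where "q = (\<lambda>(i :: nat, j, r) t. if j = a then \<xi> r t else 0)"
  obtain e where eP: "\<And>i j r t. (i, j, r) \<in> P \<Longrightarrow> e t i j r = q (i, j, r) t"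
    and e: "\<And>i j r t. (i, j, r) \<in> idx - P \<Longrightarrow> t \<ge> 0 \<Longrightarrow>
      ((\<lambda>s. (\<lambda>(i, j, r) e. err_rhs \<mu> e i j r) (i, j, r) (e s)) has_integral (e t i j r - 0)) {0..t}"
  proof (rule linear_system_solvable[of P "\<lambda>(i, j, r) e. err_rhs \<mu> e i j r" q "\<lambda>_ _. 0"])
    show "lin_form ((\<lambda>(i, j, r) e. err_rhs \<mu> e i j r) b)" if "b \<in> idx - P" for b
      using that by (cases b) (simp add: lin_form_err_rhs)
    show "P \<subseteq> idx" by (auto simp: P_def)
    show "continuous_on {0..} (q b)" for b
      using \<xi>c by (cases b; cases "fst (snd b) = a") (simp_all add: q_def)
  qed (auto simp del: idx_iff)
  have zero: "e t i j r = 0" if "i \<le> m" "j \<in> {1..m}" "r < n j" "j \<noteq> a" "rank j \<le> rank a" for t i j r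
    using eP[of i j r] that by (simp add: P_def q_def)
  have mode: "e t i a r = \<xi> r t" if "i \<in> S" "r < n a" for t i r
    using eP[of i a r] that S(1) a by (auto simp: P_def q_def)
  have "error_trajectory \<mu> e"
    unfolding error_trajectory_def
  proof (intro allI impI ballI)
    fix i j r and t :: real assume i: "i \<le> m" and j: "j \<in> {1..m}" and r: "r < n j" and t: "t \<ge> 0"
    show "((\<lambda>s. err_rhs \<mu> (e s) i j r) has_integral (e t i j r - e 0 i j r)) {0..t}"
    proof (cases "(i, j, r) \<in> P")
      case False
      then have *: "(i, j, r) \<in> idx - P" using i j r by simp
      \<comment> \<open>A solved coordinate has inhomogeneity 0 and hence initial value 0, so its
        value coincides with its increment.\<close>
      have "e 0 i j r - 0 = 0"
        by (rule has_integral_unique[OF e[OF * order_refl]]) (simp add: has_integral_refl)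
      then show ?thesis using e[OF * t] by (simp only: prod.case diff_0_right)
    next
      case True
      have prev: "l \<in> {1..m} \<and> l \<noteq> a \<and> rank l \<le> rank a" if "l \<in> NA j \<union> NC j" "rank j \<le> rank a" for l
        using rank[OF that(1)] that nbrs[of j] by auto
      have prevA: "(\<Sum>l\<in>NA j. \<Sum>s<n l. c l s * e \<tau> i' l s) = 0"
        and prevC: "(\<Sum>l\<in>NC j. \<Sum>s<n l. c l s * e \<tau> i' l s) = 0"
        if "rank j \<le> rank a" "i' \<le> m" for c \<tau> i'
        using prev[OF _ that(1)] zero that(2) by (simp_all add: sum.neutral)
      show ?thesis
      proof (cases "j = a")
        case True
        with \<open>(i, j, r) \<in> P\<close> have iS: "i \<in> S" by (simp add: P_def)
        then have i1: "i \<in> {1..m}" "i \<noteq> a" using S by auto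
        have "err_rhs \<mu> (e \<tau>) i a r = (\<Sum>q<n a. A a a $$ (r, q) * \<xi> q \<tau>)" for \<tau>
        proof -
          \<comment> \<open>All in-neighbours of i lie in S and carry the same motion, so the
            differences vanish; the reference weight is zero because i differs from a.\<close>
          have "(\<Sum>l\<le>m. W a $$ (i, l) * (e \<tau> l a r - e \<tau> i a r)) = 0"
            unfolding consensus_sum[OF a i1(1)] weight_zero(1)[OF a i1]
            using closed[OF iS] mode r iS True by simp
          then show ?thesis
            using prevA i i1 mode[OF iS] True by (simp add: err_rhs_def)
        qed
        then show ?thesis using \<xi>[of r t] mode[OF iS] r t True by simp
      next
        case False
        with True have rj: "rank j \<le> rank a" by (simp add: P_def)
        have z: "e \<tau> i' j s = 0" if "i' \<le> m" "s < n j" for \<tau> i' s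
          using zero[OF that(1) j that(2) False rj] .
        have "err_rhs \<mu> (e \<tau>) i j r = 0" for \<tau>
          using prevA[OF rj] prevC[OF rj] z i j r by (simp add: err_rhs_def)
        then show ?thesis using z i r by simp
      qed
    qed
  qed
  then show thesis using mode by (rule that)
qed

section \<open>Stability of the observer in terms of error trajectories, and necessity of
  connectivity\<close>

lemma observer_stableI:
  assumes u: "\<And>j. j \<in> {1..m} \<Longrightarrow> bounded_signal (k j) (u j)"
    and decay: "\<And>e i j r. error_trajectory \<mu> e \<Longrightarrow> i \<le> m \<Longrightarrow> j \<in> {1..m} \<Longrightarrow> r < n j \<Longrightarrow>
      ((\<lambda>t. e t i j r) \<longlongrightarrow> 0) at_top"
  shows "observer_stable m n p A B C F Ec W \<mu> u"
  unfolding observer_stable_def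
proof (intro allI impI ballI)
  fix x xh xb i assume sys: "system_trajectory m n A B u x"
    and obs: "observer_trajectory m n p A B C F Ec W \<mu> u (system_output m p C x) xh xb" and i: "i \<in> {1..m}"
  have uc: "u j t \<in> carrier_vec (k j)" if "j \<in> {1..m}" "t \<ge> 0" for j t
    using u that by (auto simp: bounded_signal_def)
  have x: "x j t \<in> carrier_vec (n j)" if "j \<in> {1..m}" "t \<ge> 0" for j t
    using sys that by (auto simp: system_trajectory_def solves_def)
  have xb: "xb j t \<in> carrier_vec (n j)" if "j \<in> {1..m}" "t \<ge> 0" for j t
    using obs that by (auto simp: observer_trajectory_def solves_def)
  have xh: "xh i j t \<in> carrier_vec (n j)" if "i \<in> {1..m}" "j \<in> {1..m}" "t \<ge> 0" for i j t
    using obs that by (cases "i = j") (auto simp: observer_trajectory_def solves_def)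
  define e where "e t = err (\<lambda>j. x j t) (\<lambda>i j. xh i j t) (\<lambda>j. xb j t)" for t
  have "error_trajectory \<mu> e"
    unfolding error_trajectory_def
    by (rule iffD1[OF observer_trajectory_iff[OF sys, where xb = xb and xh = xh]])
      (use obs uc xb xh in \<open>simp_all add: e_def\<close>)
  from decay[OF this, of i] i
  have "((\<lambda>t. xh i j t $ r - x j t $ r) \<longlongrightarrow> 0) at_top" if "j \<in> {1..m}" "r < n j" for j r
    using that by (simp add: e_def err_def)
  then show "((\<lambda>t. vnorm (stack m (\<lambda>j. xh i j t) - stack m (\<lambda>j. x j t))) \<longlongrightarrow> 0) at_top"
    using vnorm_stack_tendsto_iff[of m "xh i" n x] xh[OF i] x by blast
qed

text \<open>Every error trajectory is realised by an actual run: take some trajectory of the system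
  and let the estimates be the state plus the errors. The slot with index 0 supplies the auxiliary
  variables.\<close>

lemma observer_stableD:
  assumes u: "\<And>j. j \<in> {1..m} \<Longrightarrow> bounded_signal (k j) (u j)"
    and stable: "observer_stable m n p A B C F Ec W \<mu> u" and e: "error_trajectory \<mu> e"
    and i: "i \<in> {1..m}" and j: "j \<in> {1..m}" and r: "r < n j"
  shows "((\<lambda>t. e t i j r) \<longlongrightarrow> 0) at_top"
proof -
  have uc: "u j t \<in> carrier_vec (k j)" if "j \<in> {1..m}" "t \<ge> 0" for j t
    using u that by (auto simp: bounded_signal_def)
  obtain x where sys: "system_trajectory m n A B u x" using system_trajectory_exists[OF u] by blast
  have x: "x j t \<in> carrier_vec (n j)" if "j \<in> {1..m}" "t \<ge> 0" for j t
    using sys that by (auto simp: system_trajectory_def solves_def)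
  define xh where "xh i j t = vec (n j) (\<lambda>r. x j t $ r + e t i j r)" for i j t
  define xb where "xb = xh 0"
  define e' where "e' t = err (\<lambda>j. x j t) (\<lambda>i j. xh i j t) (\<lambda>j. xb j t)" for t
  have e': "e' t i j r = e t i j r" if "r < n j" for t i j r
    using that by (simp add: e'_def err_def xb_def xh_def)
  have rhs: "err_rhs \<mu> (e' t) i j r = err_rhs \<mu> (e t) i j r" if "i \<le> m" "j \<in> {1..m}" "r < n j" for t i j r
    using that by (intro err_rhs_cong e') auto
  have "observer_trajectory m n p A B C F Ec W \<mu> u (system_output m p C x) xh xb"
    by (rule iffD2[OF observer_trajectory_iff[OF sys, where xb = xb and xh = xh and e = e']])
      (use e uc in \<open>simp_all add: error_trajectory_def rhs e' flip: e'_def, simp_all add: xb_def xh_def\<close>)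
  then have "((\<lambda>t. vnorm (stack m (\<lambda>j. xh i j t) - stack m (\<lambda>j. x j t))) \<longlongrightarrow> 0) at_top"
    using stable sys i unfolding observer_stable_def by blast
  then have "((\<lambda>t. xh i j t $ r - x j t $ r) \<longlongrightarrow> 0) at_top"
    using vnorm_stack_tendsto_iff[of m "xh i" n x] x j r by (simp add: xh_def)
  then show ?thesis using r by (simp add: xh_def)
qed

text \<open>The gain is arbitrary here: no strength of coupling carries information about
  \<open>x a\<close> to agents that a cannot reach. The threshold in the final equivalence thus
  stems from sufficiency alone.\<close>

lemma stable_imp_strongly_connected:
  fixes rank :: "nat \<Rightarrow> nat"
  assumes rank: "\<And>j l. l \<in> NA j \<union> NC j \<Longrightarrow> rank l < rank j"
    and nh: "\<And>i. i \<in> {1..m} \<Longrightarrow> \<not> hurwitz (A i i)"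
    and u: "\<And>j. j \<in> {1..m} \<Longrightarrow> bounded_signal (k j) (u j)"
    and stable: "observer_stable m n p A B C F Ec W \<mu> u"
  shows "strongly_connected_on {1..m} Ec"
  unfolding strongly_connected_on_def
proof (intro ballI, rule ccontr)
  fix a b assume a: "a \<in> {1..m}" and b: "b \<in> {1..m}" and nreach: "(a, b) \<notin> Ec\<^sup>*"
  \<comment> \<open>This set contains b but not a, and it is closed under in-neighbours: if a
    reached an in-neighbour of i, it would reach i.\<close>
  define S where "S = {i \<in> {1..m}. (a, i) \<notin> Ec\<^sup>*}"
  obtain \<xi> :: "nat \<Rightarrow> real \<Rightarrow> real" and r where r: "r < n a" and \<xi>0: "\<not> (\<xi> r \<longlongrightarrow> 0) at_top"
    and \<xi>: "\<And>r. continuous_on {0..} (\<xi> r)" "\<And>r t. r < n a \<Longrightarrow> t \<ge> 0 \<Longrightarrow>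
      ((\<lambda>s. \<Sum>q<n a. A a a $$ (r, q) * \<xi> q s) has_integral (\<xi> r t - \<xi> r 0)) {0..t}"
    by (rule unstable_mode[OF A_carrier[OF a a] nh[OF a]], rule that)
  have S: "S \<subseteq> {1..m}" "a \<notin> S" by (auto simp: S_def)
  have closed: "l \<in> S" if "i \<in> S" "l \<in> in_nbrs Ec i" for i l
    using that nbrs(3)[of i] by (auto simp: S_def in_nbrs_def intro: rtrancl_into_rtrancl)
  obtain e where e: "error_trajectory \<mu> e" and mode: "\<And>i r t. i \<in> S \<Longrightarrow> r < n a \<Longrightarrow> e t i a r = \<xi> r t"
    by (rule error_trajectory_with_mode[where rank = rank and a = a and S = S and \<xi> = \<xi> and \<mu> = \<mu>],
        erule rank, rule a, rule S(1), rule S(2), erule (1) closed, rule \<xi>(1), erule (1) \<xi>(2), rule that)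
  have "b \<in> S" using b nreach by (simp add: S_def)
  with observer_stableD[OF u stable e b a r] mode r \<xi>0 show False by simp
qed

end

theorem theorem1:
  fixes m :: nat
    and n k p :: "nat \<Rightarrow> nat"
    and A C :: "nat \<Rightarrow> nat \<Rightarrow> real mat"
    and B F :: "nat \<Rightarrow> real mat"
    and Ec :: "(nat \<times> nat) set"
    and W :: "nat \<Rightarrow> real mat"
  assumes "m \<ge> 1"
    and "\<And>i j. i \<in> {1..m} \<Longrightarrow> j \<in> {1..m} \<Longrightarrow> A i j \<in> carrier_mat (n i) (n j)"
    and "\<And>i. i \<in> {1..m} \<Longrightarrow> B i \<in> carrier_mat (n i) (k i)"
    and "\<And>i j. i \<in> {1..m} \<Longrightarrow> j \<in> {1..m} \<Longrightarrow> C i j \<in> carrier_mat (p i) (n j)"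
    and "\<And>i. i \<in> {1..m} \<Longrightarrow> F i \<in> carrier_mat (n i) (p i)"
    and "Ec \<subseteq> {1..m} \<times> {1..m}" and "\<And>i. (i, i) \<notin> Ec"
    and A1: "\<And>i. i \<in> {1..m} \<Longrightarrow> observable (A i i) (C i i)"
    and A2: "acyclic (coupling_graph m A)" "acyclic (coupling_graph m C)"
      "\<exists>xs. topological_ordering {1..m} (coupling_graph m A) xs \<and>
            topological_ordering {1..m} (coupling_graph m C) xs"
    and A3: "\<And>i. i \<in> {1..m} \<Longrightarrow> \<not> hurwitz (A i i)"
    and "\<And>i. i \<in> {1..m} \<Longrightarrow> hurwitz (A i i - F i * C i i)"
    and "consensus_weights m Ec W"
  shows "\<exists>\<mu>\<^sub>0>0. \<forall>\<mu>>\<mu>\<^sub>0. \<forall>u. (\<forall>i\<in>{1..m}. bounded_signal (k i) (u i)) \<longrightarrow>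
           (observer_stable m n p A B C F Ec W \<mu> u \<longleftrightarrow> strongly_connected_on {1..m} Ec)"
proof -
  interpret observer_network m n k p A C B F Ec W
    by unfold_locales (use assms in auto)
  from A2(3) obtain xs where xs: "topological_ordering {1..m} (coupling_graph m A) xs"
    "topological_ordering {1..m} (coupling_graph m C) xs" by blast
  define rank where "rank = inv_into {..<length xs} ((!) xs)"
  have rank: "rank l < rank j" if "l \<in> NA j \<union> NC j" for j l
    using that xs[THEN topological_ordering_rank] unfolding rank_def in_nbrs_def by blast
  \<comment> \<open>Connectivity is put under the existential quantifier because the threshold has
    to be fixed before the equivalence is split into its two directions.\<close>
  have "\<exists>c. strongly_connected_on {1..m} Ec \<longrightarrow> (\<forall>\<mu>>c. \<forall>\<alpha> \<beta>.
      eigenvalue (map_mat complex_of_real (A j j)) \<alpha> \<longrightarrow> eigenvalue (grounded_laplacian m (W j)) \<beta> \<longrightarrow>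
      Re \<alpha> < \<mu> * Re \<beta>)" if j: "j \<in> {1..m}" for j
  proof (cases "strongly_connected_on {1..m} Ec")
    case True
    have "map_mat complex_of_real (A j j) \<in> carrier_mat (n j) (n j)" using A_carrier[OF j j] by simp
    from dominating_gain_exists[OF this grounded_laplacian_carrier
        grounded_laplacian_eigenvalue[OF weights Ec_subset True j]]
    show ?thesis by blast
  qed simp
  then obtain c where c: "\<And>j \<mu> \<alpha> \<beta>. strongly_connected_on {1..m} Ec \<Longrightarrow> j \<in> {1..m} \<Longrightarrow> \<mu> > c j \<Longrightarrow>
      eigenvalue (map_mat complex_of_real (A j j)) \<alpha> \<Longrightarrow> eigenvalue (grounded_laplacian m (W j)) \<beta> \<Longrightarrow>
      Re \<alpha> < \<mu> * Re \<beta>"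
    by metis
  \<comment> \<open>The sum of absolute values dominates every \<open>c j\<close>, and the added 1
    makes the comparison strict and the threshold positive.\<close>
  define \<mu>0 where "\<mu>0 = 1 + (\<Sum>j\<in>{1..m}. \<bar>c j\<bar>)"
  have \<mu>0c: "c j < \<mu>0" if "j \<in> {1..m}" for j
    using member_le_sum[of j "{1..m}" "\<lambda>j. \<bar>c j\<bar>"] that by (simp add: \<mu>0_def)
  have "observer_stable m n p A B C F Ec W \<mu> u \<longleftrightarrow> strongly_connected_on {1..m} Ec"
    if \<mu>: "\<mu> > \<mu>0" and u: "\<forall>i\<in>{1..m}. bounded_signal (k i) (u i)" for \<mu> u
  proof
    assume "observer_stable m n p A B C F Ec W \<mu> u"
    then show "strongly_connected_on {1..m} Ec"
      using stable_imp_strongly_connected[of rank u \<mu>] rank A3 u by blast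
  next
    assume sc: "strongly_connected_on {1..m} Ec"
    show "observer_stable m n p A B C F Ec W \<mu> u"
    proof (rule observer_stableI)
      fix e i j r assume "error_trajectory \<mu> e" "i \<le> m" "j \<in> {1..m}" "r < n j"
      then show "((\<lambda>t. e t i j r) \<longlongrightarrow> 0) at_top"
      proof (rule error_decay[where rank = rank, rotated 3])
        show "Re \<alpha> < \<mu> * Re \<beta>" if "j \<in> {1..m}" "eigenvalue (map_mat complex_of_real (A j j)) \<alpha>"
          "eigenvalue (grounded_laplacian m (W j)) \<beta>" for j \<alpha> \<beta>
          by (rule c[OF sc that(1) order.strict_trans[OF \<mu>0c[OF that(1)] \<mu>] that(2,3)])
      qed (use rank assms in blast)+
    qed (use u in blast)
  qed
  moreover have "\<mu>0 > 0" unfolding \<mu>0_def by (smt (verit) sum_nonneg)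
  ultimately show ?thesis by blast
qed

end
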